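(* Let $d\in\mathbb N$. If $f\in\mathbb C\langle X_1,\dots,X_g,X_1^{\intercal},\dots,X_g^{\intercal}\rangle$ of degree $d-1$ is positive on all $g$-tuples of unitaries of size $(2g+1)^d$, then $$f\in\mathcal C_{2d}+(1-X_1^{\intercal}X_1,\,1-X_1X_1^{\intercal},\,\dots,\,1-X_g^{\intercal}X_g,\,1-X_gX_g^{\intercal}).$$
   Context: $\mathbb C\langle X_1,\dots,X_g,X_1^{\intercal},\dots,X_g^{\intercal}\rangle$ is the free associative unital $\mathbb C$-algebra in $2g$ freely noncommuting letters with the conjugate-linear involution ${}^{\intercal}$ (an antiautomorphism) exchanging $X_j$ and $X_j^{\intercal}$. The evaluation of $f$ at $A\in M_n(\mathbb C)^g$ replaces $X_j$ by $A_j$ and $X_j^{\intercal}$ by the conjugate transpose $A_j^*$. A polynomial is positive on a set of matrix tuples if its evaluation at each tuple of the set is a (Hermitian) positive semidefinite matrix. $\mathcal P_d$ is the subspace of polynomials of degree at most $d$, and $\mathcal C_{2d}=\operatorname{co}\{p^{\intercal}p: p\in\mathcal P_d\}$ (convex hull) is the convex cone of sums of Hermitian squares. "Unitaries of size $n$" are unitary matrices in $M_n(\mathbb C)$. $(\cdots)$ denotes the two-sided ideal generated by the listed elements. *)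

theory Defs
  imports
    "HOL-Analysis.Analysis"
    "HOL-Analysis.Finite_Function_Topology"
    "HOL-Library.Poly_Mapping"
    "HOL-Algebra.Ideal"
    "Jordan_Normal_Form.VS_Connect"
    "Jordan_Normal_Form.Schur_Decomposition"
begin

section \<open>The free algebra with involution\<close>

text \<open>Words are lists under concatenation. The additive notation is forced by
  \<^theory>\<open>HOL-Library.Poly_Mapping\<close>, whose product is convolution over a
  \<^class>\<open>monoid_add\<close> of exponents.\<close>

instantiation list :: (type) monoid_add
begin

definition zero_list :: "'a list" where "zero_list = []"

definition plus_list :: "'a list \<Rightarrow> 'a list \<Rightarrow> 'a list" where "plus_list = append"

instance by standard (simp_all add: zero_list_def plus_list_def)

end

text \<open>\<open>Var j\<close> and \<open>VarT j\<close> are the letters $X_j$ and $X_j^\intercal$; the index type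
  \<open>'g\<close> has $g$ elements.\<close>

datatype 'g letter = Var 'g | VarT 'g

type_synonym 'g ncpoly = "'g letter list \<Rightarrow>\<^sub>0 complex"

definition nc_var :: "'g \<Rightarrow> 'g ncpoly" where
  "nc_var j = Poly_Mapping.single [Var j] 1"

definition nc_varT :: "'g \<Rightarrow> 'g ncpoly" where
  "nc_varT j = Poly_Mapping.single [VarT j] 1"

fun letter_adj :: "'g letter \<Rightarrow> 'g letter" where
  "letter_adj (Var j) = VarT j"
| "letter_adj (VarT j) = Var j"

definition word_adj :: "'g letter list \<Rightarrow> 'g letter list" where
  "word_adj w = rev (map letter_adj w)"

definition nc_adj :: "'g ncpoly \<Rightarrow> 'g ncpoly" where
  "nc_adj f = (\<Sum>w\<in>Poly_Mapping.keys f.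
     Poly_Mapping.single (word_adj w) (cnj (Poly_Mapping.lookup f w)))"

text \<open>The zero polynomial gets degree \<open>0\<close>.\<close>

definition nc_degree :: "'g ncpoly \<Rightarrow> nat" where
  "nc_degree f = Max (insert 0 (length ` Poly_Mapping.keys f))"

definition polys_upto :: "nat \<Rightarrow> 'g ncpoly set" where
  "polys_upto d = {p. nc_degree p \<le> d}"

text \<open>The cone $\mathcal C_{2d}$ is indexed here by \<open>d\<close>.\<close>

definition sos_cone :: "nat \<Rightarrow> 'g ncpoly set" where
  "sos_cone d = convex hull {nc_adj p * p | p. p \<in> polys_upto d}"


section \<open>Evaluation at matrix tuples\<close>

fun letter_eval :: "('g \<Rightarrow> complex mat) \<Rightarrow> 'g letter \<Rightarrow> complex mat" where
  "letter_eval A (Var j) = A j"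
| "letter_eval A (VarT j) = mat_adjoint (A j)"

fun word_eval :: "nat \<Rightarrow> ('g \<Rightarrow> complex mat) \<Rightarrow> 'g letter list \<Rightarrow> complex mat" where
  "word_eval n A [] = 1\<^sub>m n"
| "word_eval n A (x # w) = letter_eval A x * word_eval n A w"

text \<open>$f(A) = \sum_w f_w\, w(A)$, written entrywise because \<^typ>\<open>complex mat\<close>
  is not of class \<^class>\<open>comm_monoid_add\<close>.\<close>

definition nc_eval :: "nat \<Rightarrow> ('g \<Rightarrow> complex mat) \<Rightarrow> 'g ncpoly \<Rightarrow> complex mat" where
  "nc_eval n A f = mat n n (\<lambda>(i, k).
     \<Sum>w\<in>Poly_Mapping.keys f. Poly_Mapping.lookup f w * word_eval n A w $$ (i, k))"

definition unitary_mats :: "nat \<Rightarrow> complex mat set" where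
  "unitary_mats n =
     {U \<in> carrier_mat n n. mat_adjoint U * U = 1\<^sub>m n \<and> U * mat_adjoint U = 1\<^sub>m n}"

text \<open>\<open>0 \<le> z\<close> for complex \<open>z\<close> (from \<^theory>\<open>HOL-Library.Complex_Order\<close>) means that \<open>z\<close>
  is real and nonnegative.\<close>

definition psd_mat :: "nat \<Rightarrow> complex mat \<Rightarrow> bool" where
  "psd_mat n M \<longleftrightarrow> M \<in> carrier_mat n n \<and> mat_adjoint M = M \<and>
     (\<forall>v\<in>carrier_vec n. 0 \<le> (M *\<^sub>v v) \<bullet>c v)"

definition positive_on :: "nat \<Rightarrow> ('g \<Rightarrow> complex mat) set \<Rightarrow> 'g ncpoly \<Rightarrow> bool" where
  "positive_on n S f \<longleftrightarrow> (\<forall>A\<in>S. psd_mat n (nc_eval n A f))"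


section \<open>The ideal of unitarity relations\<close>

definition unitary_relations :: "'g ncpoly set" where
  "unitary_relations = (\<Union>j. {1 - nc_varT j * nc_var j, 1 - nc_var j * nc_varT j})"

text \<open>\<^const>\<open>genideal\<close> is the two-sided ideal generated by a set, also over
  noncommutative rings; \<^term>\<open>class_ring\<close> is the type-class ring as a record.\<close>

definition unitary_ideal :: "'g ncpoly set" where
  "unitary_ideal = genideal class_ring unitary_relations"

end

theory Submission
  imports Defs
begin

text \<open>
  Modulo the unitarity relations the free algebra becomes the group algebra of the free group on
  \<open>g\<close> generators, whose elements are the freely reduced words. Let \<open>B\<close> be the set of reduced words
  of length at most \<open>d\<close>; it has at most $(2g+1)^d$ elements. Write \<open>F\<close> for the image of \<open>f\<close> in the
  group algebra. A sum of Hermitian squares of polynomials supported on \<open>B\<close> has as image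
  $T(G) = \sum_{v,w\in B} G_{vw}\, v^{-1}w$ for a positive semidefinite Gram matrix \<open>G\<close>, so the claim
  is that \<open>F\<close> has the form $T(G)$.

  The coefficient of $T(G)$ at the neutral element is the trace of \<open>G\<close>. Hence the cone of all
  $T(G)$ is closed, and among its elements there is one nearest to \<open>F\<close> in the Euclidean norm of the
  coefficients. Let \<open>r\<close> be the difference between it and \<open>F\<close>. The first-order conditions at the
  minimum say that the functional $L = \langle\,\cdot\,, r\rangle$ is nonnegative on the cone and
  vanishes on the nearest point (up to real parts, see \<open>separating_kernel\<close>), so that $L(F)$ has
  real part $-\|r\|^2$.

  The functional \<open>L\<close> comes from unitary matrices, by a truncated GNS construction
  (\<open>gns_unitaries\<close>): a Gram factorisation of the kernel $L(v^{-1}w)$ on \<open>B\<close> gives vectors $x_w$ in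
  $\mathbb C^N$ for any $N \ge |B|$. Left multiplication by the \<open>j\<close>-th generator, wherever it does
  not lead out of \<open>B\<close>, preserves inner products of these vectors and therefore extends to a unitary
  $U_j$ (\<open>unitary_extension\<close>). Then $w(U)x_1 = x_w$ for every word \<open>w\<close> of length at most \<open>d\<close>, hence
  $\langle f(U)x_1,x_1\rangle = L(F)$, which is nonnegative by hypothesis. It follows that $r = 0$.

  The construction requires the kernel $L(v^{-1}w)$ to be Hermitian, and it is so because \<open>F\<close> is
  Hermitian. The latter follows from the same construction, applied to the functional that reads off the coefficient at the neutral element: there the
  vectors $x_w$ are orthonormal, and the matrix of the Hermitian \<open>f(U)\<close> displays the coefficients
  of \<open>F\<close> (\<open>group_coeff_hermitian\<close>).
\<close>

(* the infix $ below is the index operator of carrier-based vectors *)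
unbundle no vec_syntax

section \<open>Free reduction of words\<close>

text \<open>Left multiplication of a reduced word by a letter, cancelling at the front if possible; since
  only the front can become reducible, folding \<open>push\<close> over a word reduces it freely.\<close>

fun push :: "'g letter \<Rightarrow> 'g letter list \<Rightarrow> 'g letter list" where
  "push x [] = [x]"
| "push x (y # u) = (if y = letter_adj x then u else x # y # u)"

definition red :: "'g letter list \<Rightarrow> 'g letter list" where
  "red w = foldr push w []"

abbreviation reduced :: "'g letter list \<Rightarrow> bool" where
  "reduced \<equiv> successively (\<lambda>x y. y \<noteq> letter_adj x)"

lemma letter_adj_letter_adj [simp]: "letter_adj (letter_adj x) = x"
  by (cases x) auto

lemma red_Nil [simp]: "red [] = []"
  by (simp add: red_def)

lemma red_Cons: "red (x # w) = push x (red w)"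
  by (simp add: red_def)

lemma reduced_push: "reduced w \<Longrightarrow> reduced (push x w)"
  by (cases w) (auto simp: successively_Cons)

lemma reduced_red: "reduced (red w)"
  by (induction w) (auto simp: red_Cons reduced_push)

lemma red_reduced: "reduced w \<Longrightarrow> red w = w"
proof (induction w)
  case (Cons x w)
  then show ?case by (cases w) (auto simp: red_Cons)
qed simp

text \<open>Every letter therefore permutes the reduced words, and adjacent inverse letters act trivially;
  this action of the free group is what makes \<open>red\<close> insensitive to cancellations.\<close>

lemma push_push_letter_adj: "reduced w \<Longrightarrow> push x (push (letter_adj x) w) = w"
proof (cases w)
  case (Cons y u)
  assume "reduced w"
  with Cons show ?thesis by (cases u) auto
qed simp

lemma length_push: "length (push x w) \<le> Suc (length w)"
  by (cases w) auto

lemma length_red: "length (red w) \<le> length w"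
proof (induction w)
  case (Cons x w)
  then show ?case using length_push[of x "red w"] by (simp add: red_Cons)
qed simp

lemma red_cancel: "red (a @ x # letter_adj x # b) = red (a @ b)"
proof (induction a)
  case Nil
  show ?case by (simp add: red_Cons push_push_letter_adj reduced_red)
qed (simp add: red_Cons)

text \<open>The principle by which everything about words passes to reduced words: a word is connected to
  its reduction by deletions of adjacent inverse letters, so whatever does not see such deletions
  does not see the reduction. It is applied to the group operations and to residue classes modulo
  the unitarity relations.\<close>

lemma cancellation_invariant_red:
  assumes inv: "\<And>a x b. F (a @ x # letter_adj x # b) = F (a @ b)"
  shows "F (red w) = F w"
proof -
  have "F (a @ red w) = F (a @ w)" for a
  proof (induction w arbitrary: a)
    case (Cons x w)
    have "F (a @ red (x # w)) = F (a @ x # red w)"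
    proof (cases "red w")
      case (Cons y u)
      then show ?thesis using inv[of a x u] by (auto simp: red_Cons)
    qed (simp add: red_Cons)
    also have "\<dots> = F (a @ x # w)" using Cons.IH[of "a @ [x]"] by simp
    finally show ?case .
  qed simp
  from this[of "[]"] show ?thesis by simp
qed

lemma red_append_red_right: "red (v @ red w) = red (v @ w)"
  by (rule cancellation_invariant_red[where F = "\<lambda>w. red (v @ w)"])
     (use red_cancel[of "v @ _"] in simp)

lemma red_append_red_left: "red (red v @ w) = red (v @ w)"
  by (rule cancellation_invariant_red[where F = "\<lambda>v. red (v @ w)"])
     (use red_cancel[of _ _ "_ @ w"] in simp)

lemma word_adj_Nil [simp]: "word_adj [] = []"
  and word_adj_Cons: "word_adj (x # w) = word_adj w @ [letter_adj x]"
  and word_adj_append: "word_adj (v @ w) = word_adj w @ word_adj v"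
  and word_adj_word_adj [simp]: "word_adj (word_adj w) = w"
  and length_word_adj [simp]: "length (word_adj w) = length w"
  by (auto simp: word_adj_def rev_map comp_def)

lemma red_word_adj_red: "red (word_adj (red w)) = red (word_adj w)"
  by (rule cancellation_invariant_red[where F = "\<lambda>w. red (word_adj w)"])
     (use red_cancel in \<open>simp add: word_adj_append word_adj_Cons\<close>)

lemma red_append_word_adj: "red (w @ word_adj w) = []"
proof (induction w)
  case (Cons x w)
  have "red (x # w @ word_adj w @ [letter_adj x]) = red ([x] @ red (w @ word_adj w) @ [letter_adj x])"
    by (metis append.assoc append_Cons append_Nil red_append_red_left red_append_red_right)
  then show ?case by (simp add: Cons.IH word_adj_Cons red_Cons)
qed simp

text \<open>The reduced word of the group element $v^{-1}w$.\<close>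

definition quot :: "'g letter list \<Rightarrow> 'g letter list \<Rightarrow> 'g letter list" where
  "quot v w = red (word_adj v @ w)"

text \<open>Invariance of $v^{-1}w$ under simultaneous left translation; this is why left multiplication by
  a generator is isometric for a kernel that depends on $v^{-1}w$ only.\<close>

lemma quot_push: "quot (push x v) (push x w) = quot v w"
  if "reduced v" "reduced w"
proof -
  have p: "push x u = red (x # u)" if "reduced u" for u
    using that by (simp add: red_Cons red_reduced)
  have "quot (push x v) (push x w) = red (red (word_adj (x # v)) @ red (x # w))"
    unfolding quot_def p[OF that(1)] p[OF that(2)]
    by (metis red_append_red_left red_word_adj_red)
  also have "\<dots> = red (word_adj v @ letter_adj x # x # w)"
    by (simp add: red_append_red_left red_append_red_right word_adj_Cons)
  also have "\<dots> = quot v w"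
    using red_cancel[of "word_adj v" "letter_adj x" w] by (simp add: quot_def)
  finally show ?thesis .
qed

lemma quot_eq_Nil_iff: "quot v w = [] \<longleftrightarrow> v = w" if "reduced v" "reduced w"
proof
  assume "quot v w = []"
  then have "red (v @ quot v w) = v" using that by (simp add: red_reduced)
  moreover have "red (v @ quot v w) = red (red (v @ word_adj v) @ w)"
    by (simp add: quot_def red_append_red_left red_append_red_right)
  ultimately show "v = w" using that by (simp add: red_append_word_adj red_reduced)
next
  assume "v = w"
  then show "quot v w = []"
    using red_append_word_adj[of "word_adj w"] by (simp add: quot_def)
qed

lemma red_word_adj_quot: "red (word_adj (quot v w)) = quot w v"
  by (simp add: quot_def red_word_adj_red word_adj_append)

lemma quot_red: "quot (red v) (red w) = quot v w"
  unfolding quot_def by (metis red_append_red_left red_append_red_right red_word_adj_red)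

lemma quot_eq_Nil_iff_red: "quot v w = [] \<longleftrightarrow> red v = red w"
  by (metis quot_red quot_eq_Nil_iff reduced_red)

lemma red_word_adj_eq_iff: "red (word_adj w) = red v \<longleftrightarrow> red w = red (word_adj v)"
  by (metis red_word_adj_red word_adj_word_adj)

lemma quot_eq_red_word_adj_iff:
  assumes "reduced u"
  shows "quot v w = red (word_adj u) \<longleftrightarrow> quot w v = u"
proof -
  have "red (quot v w) = quot v w" by (simp add: quot_def red_reduced reduced_red)
  then show ?thesis
    using red_word_adj_eq_iff[of "quot v w" u] assms by (auto simp: red_word_adj_quot red_reduced)
qed

definition word_ball :: "nat \<Rightarrow> 'g letter list set" where
  "word_ball d = {w. reduced w \<and> length w \<le> d}"

lemma UNIV_letter: "(UNIV :: 'g letter set) = range Var \<union> range VarT"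
proof -
  have "x \<in> range Var \<union> range VarT" for x :: "'g letter" by (cases x) auto
  then show ?thesis by (simp add: set_eq_iff)
qed

lemma finite_UNIV_letter: "finite (UNIV :: 'g::finite letter set)"
  unfolding UNIV_letter by simp

lemma card_UNIV_letter: "card (UNIV :: 'g::finite letter set) = 2 * CARD('g)"
proof -
  have "card (UNIV :: 'g letter set) = card (range (Var :: 'g \<Rightarrow> _)) + card (range (VarT :: 'g \<Rightarrow> _))"
    unfolding UNIV_letter by (rule card_Un_disjoint) auto
  then show ?thesis by (simp add: card_image inj_def)
qed

lemma finite_word_ball: "finite (word_ball d :: 'g::finite letter list set)"
  by (rule finite_subset[OF _ finite_lists_length_le[OF finite_UNIV_letter, of d]])
     (auto simp: word_ball_def)

lemma sum_powers_le: "(\<Sum>i\<le>d. q ^ i) \<le> (q + 1 :: nat) ^ d"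
proof (induction d)
  case (Suc d)
  have "q ^ d \<le> (q + 1) ^ d" by (intro power_mono) auto
  then have "q * q ^ d \<le> q * (q + 1) ^ d" by (rule mult_left_mono) simp
  with Suc have "(\<Sum>i\<le>d. q ^ i) + q * q ^ d \<le> (q + 1) ^ d + q * (q + 1) ^ d" by linarith
  then show ?case by simp
qed simp

lemma card_word_ball:
  "card (word_ball d :: 'g::finite letter list set) \<le> (2 * CARD('g) + 1) ^ d"
proof -
  have "card (word_ball d :: 'g letter list set)
      \<le> card {w :: 'g letter list. set w \<subseteq> UNIV \<and> length w \<le> d}"
    by (intro card_mono finite_lists_length_le finite_UNIV_letter) (auto simp: word_ball_def)
  also have "\<dots> = (\<Sum>i\<le>d. (2 * CARD('g)) ^ i)"
    by (subst card_lists_length_le[OF finite_UNIV_letter]) (simp add: card_UNIV_letter)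
  finally show ?thesis using sum_powers_le[of "2 * CARD('g)" d] by linarith
qed

lemma red_in_word_ball: "length w \<le> d \<Longrightarrow> red w \<in> word_ball d"
  using length_red[of w] by (simp add: word_ball_def reduced_red)

lemma word_ball_reduced: "w \<in> word_ball d \<Longrightarrow> reduced w"
  by (simp add: word_ball_def)

lemma quot_in_word_ball: "v \<in> word_ball d \<Longrightarrow> w \<in> word_ball d \<Longrightarrow> quot v w \<in> word_ball (2 * d)"
  unfolding quot_def by (rule red_in_word_ball) (auto simp: word_ball_def)

section \<open>Positive semidefinite kernels and Gram factorisations\<close>

definition quad_form :: "'b set \<Rightarrow> ('b \<Rightarrow> 'b \<Rightarrow> complex) \<Rightarrow> ('b \<Rightarrow> complex) \<Rightarrow> complex" where
  "quad_form B K c = (\<Sum>v\<in>B. \<Sum>w\<in>B. cnj (c v) * K v w * c w)"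

definition psd_kernel :: "'b set \<Rightarrow> ('b \<Rightarrow> 'b \<Rightarrow> complex) \<Rightarrow> bool" where
  "psd_kernel B K \<longleftrightarrow> (\<forall>v\<in>B. \<forall>w\<in>B. K w v = cnj (K v w)) \<and> (\<forall>c. 0 \<le> Re (quad_form B K c))"

definition gram :: "nat \<Rightarrow> (nat \<Rightarrow> 'b \<Rightarrow> complex) \<Rightarrow> 'b \<Rightarrow> 'b \<Rightarrow> complex" where
  "gram n a v w = (\<Sum>i<n. a i v * cnj (a i w))"

text \<open>The form as a polynomial in the single coordinate \<open>c b\<close>; completing the square in it gives the
  Schur complement.\<close>

lemma quad_form_insert:
  assumes "finite B" "b \<notin> B" "\<forall>v\<in>B. K v b = cnj (K b v)"
  shows "quad_form (insert b B) K c =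
    cnj (c b) * K b b * c b + cnj (c b) * (\<Sum>w\<in>B. K b w * c w)
    + c b * cnj (\<Sum>w\<in>B. K b w * c w) + quad_form B K c"
proof -
  define s where "s = (\<Sum>w\<in>B. K b w * c w)"
  have 1: "(\<Sum>v\<in>B. cnj (c v) * (K v b * c b)) = c b * cnj s"
    unfolding s_def cnj_sum sum_distrib_left using assms(3) by (intro sum.cong) auto
  have 2: "(\<Sum>w\<in>B. cnj (c b) * (K b w * c w)) = cnj (c b) * s"
    by (simp add: s_def sum_distrib_left)
  show ?thesis
    unfolding s_def[symmetric] unfolding quad_form_def using assms(1,2)
    by (simp add: sum.distrib 1 2 mult.assoc)
qed

lemma psd_kernel_mono: "psd_kernel B K" if "psd_kernel A K" "B \<subseteq> A" "finite A"
proof -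
  have "quad_form B K c = quad_form A K (\<lambda>v. if v \<in> B then c v else 0)" for c
    unfolding quad_form_def using that
    by (intro sum.mono_neutral_cong_left) (auto intro!: sum.mono_neutral_cong_left sum.neutral)
  then show ?thesis using that unfolding psd_kernel_def by fastforce
qed

lemma psd_kernel_diag:
  assumes "psd_kernel B K" "b \<in> B" "finite B"
  shows "0 \<le> Re (K b b)" "K b b = of_real (Re (K b b))"
proof -
  have "psd_kernel {b} K" using assms by (intro psd_kernel_mono[OF assms(1)]) auto
  then have "0 \<le> Re (quad_form {b} K (\<lambda>_. 1))" by (simp add: psd_kernel_def)
  then show "0 \<le> Re (K b b)" by (simp add: quad_form_def)
  have "K b b = cnj (K b b)" using assms unfolding psd_kernel_def by blast
  then show "K b b = of_real (Re (K b b))" by (simp add: complex_eq_iff)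
qed

text \<open>If the entry were \<open>z \<noteq> 0\<close>, the vector with entries $-tz$ at \<open>b\<close> and \<open>1\<close> at \<open>v\<close> would make the
  form $K_{vv} - 2t|z|^2$, which is negative for large \<open>t\<close>.\<close>

lemma psd_kernel_zero_row:
  assumes K: "psd_kernel B K" "finite B" and b: "b \<in> B" "K b b = 0" and v: "v \<in> B"
  shows "K b v = 0"
proof (cases "v = b")
  case False
  define z where "z = K b v"
  have psd: "psd_kernel {b, v} K" using K b v by (intro psd_kernel_mono[OF K(1)]) auto
  have h: "K v b = cnj z" using K b v unfolding psd_kernel_def z_def by blast
  have ineq: "2 * t * (cmod z)\<^sup>2 \<le> Re (K v v)" for t :: real
  proof -
    let ?c = "\<lambda>u. if u = b then - (of_real t) * z else 1"
    have "quad_form {b, v} K ?c = K v v - 2 * of_real t * (z * cnj z)"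
    proof -
      have "quad_form {b, v} K ?c = cnj (?c b) * K b b * ?c b + cnj (?c b) * (\<Sum>w\<in>{v}. K b w * ?c w)
        + ?c b * cnj (\<Sum>w\<in>{v}. K b w * ?c w) + quad_form {v} K ?c"
        using False h by (intro quad_form_insert) (auto simp: z_def)
      also have "\<dots> = K v v - 2 * of_real t * (z * cnj z)"
        using False b(2) by (simp add: quad_form_def z_def[symmetric])
      finally show ?thesis .
    qed
    then have "Re (quad_form {b, v} K ?c) = Re (K v v) - 2 * t * (cmod z)\<^sup>2"
      by (simp add: complex_mult_cnj cmod_power2 flip: of_real_power)
    moreover have "0 \<le> Re (quad_form {b, v} K ?c)" using psd by (simp add: psd_kernel_def)
    ultimately show ?thesis by simp
  qed
  have "z = 0"
  proof (rule ccontr)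
    assume "z \<noteq> 0"
    then have "2 * ((1 + Re (K v v)) / (2 * (cmod z)\<^sup>2)) * (cmod z)\<^sup>2 = 1 + Re (K v v)"
      by (simp add: field_simps)
    with ineq[of "(1 + Re (K v v)) / (2 * (cmod z)\<^sup>2)"] show False by simp
  qed
  then show ?thesis by (simp add: z_def)
qed (use b in simp)

text \<open>The form of the complement at \<open>c\<close> is the minimum of the form of \<open>K\<close> over all choices of the
  coordinate at \<open>b\<close>. In case \<open>K b b = 0\<close> the subtracted term is \<open>0\<close> because of division by zero, and
  the statement is mere restriction.\<close>

lemma psd_kernel_schur_complement:
  assumes "finite B" "b \<notin> B" and K: "psd_kernel (insert b B) K"
  shows "psd_kernel B (\<lambda>v w. K v w - K v b * K b w / K b b)"
    (is "psd_kernel B ?K'")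
  unfolding psd_kernel_def
proof (intro conjI ballI allI)
  have h: "K w v = cnj (K v w)" if "v \<in> insert b B" "w \<in> insert b B" for v w
    using K that by (auto simp: psd_kernel_def)
  define k where "k = Re (K b b)"
  have k: "K b b = of_real k"
    using psd_kernel_diag(2)[OF K] assms(1) by (simp add: k_def)
  show "K w v - K w b * K b v / K b b = cnj (K v w - K v b * K b w / K b b)"
    if "v \<in> B" "w \<in> B" for v w
  proof -
    have "K w v = cnj (K v w)" "K w b = cnj (K b w)" "K b v = cnj (K v b)"
      by (rule h; use that in simp)+
    then show ?thesis by (simp add: k)
  qed
  fix c
  define s where "s = (\<Sum>w\<in>B. K b w * c w)"
  \<comment> \<open>the minimising coordinate at \<open>b\<close>\<close>
  let ?d = "c(b := - s / k)"
  have s': "(\<Sum>v\<in>B. cnj (c v) * K v b) = cnj s"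
    unfolding s_def cnj_sum
    by (intro sum.cong refl) (use h[of b] in auto)
  have "quad_form B ?K' c = quad_form B K c - cnj s * s / k"
  proof -
    have "quad_form B ?K' c
      = quad_form B K c - (\<Sum>v\<in>B. \<Sum>w\<in>B. (cnj (c v) * K v b) * (K b w * c w) / k)"
      by (simp add: quad_form_def k algebra_simps diff_divide_distrib sum_subtractf)
    also have "(\<Sum>v\<in>B. \<Sum>w\<in>B. (cnj (c v) * K v b) * (K b w * c w) / k) = cnj s * s / k"
      unfolding s'[symmetric] unfolding s_def sum_product sum_divide_distrib ..
    finally show ?thesis .
  qed
  also have "\<dots> = quad_form (insert b B) K ?d"
  proof -
    have "quad_form B K ?d = quad_form B K c"
      unfolding quad_form_def using assms(2) by (auto intro!: sum.cong)
    moreover have "(\<Sum>w\<in>B. K b w * ?d w) = s"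
      unfolding s_def using assms(2) by (auto intro!: sum.cong)
    moreover have "\<forall>v\<in>B. K v b = cnj (K b v)" using h[of b] by simp
    ultimately have "quad_form (insert b B) K ?d
      = cnj (?d b) * K b b * ?d b + cnj (?d b) * s + ?d b * cnj s + quad_form B K c"
      using quad_form_insert[OF assms(1,2), of K ?d] by metis
    then show ?thesis by (cases "k = 0") (simp_all add: k field_simps)
  qed
  finally show "0 \<le> Re (quad_form B ?K' c)"
    using K by (simp add: psd_kernel_def)
qed

text \<open>Cholesky factorisation: each point of \<open>B\<close> contributes one column, normalised by the square root
  of its pivot, and the Schur complement remains. A zero pivot gives a zero column, as its row
  vanishes already. Both vectors realising a positive functional and the polynomials in a sum of
  squares are read off from this.\<close>

lemma psd_kernel_imp_gram:
  assumes "finite B" "psd_kernel B K"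
  shows "\<exists>a. \<forall>v\<in>B. \<forall>w\<in>B. K v w = gram (card B) a v w"
  using assms
proof (induction B arbitrary: K rule: finite_induct)
  case (insert b B)
  let ?K' = "\<lambda>v w. K v w - K v b * K b w / K b b"
  from insert.IH[OF psd_kernel_schur_complement[OF insert.hyps insert.prems]]
  obtain a where a: "\<forall>v\<in>B. \<forall>w\<in>B. ?K' v w = gram (card B) a v w" by blast
  define k where "k = Re (K b b)"
  have k: "K b b = of_real k" "0 \<le> k"
    using psd_kernel_diag[OF insert.prems] insert.hyps(1) by (auto simp: k_def)
  have h: "K w v = cnj (K v w)" if "v \<in> insert b B" "w \<in> insert b B" for v w
    using insert.prems that by (auto simp: psd_kernel_def)
  have row: "k = 0 \<Longrightarrow> v \<in> insert b B \<Longrightarrow> K b v = 0" for v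
    using psd_kernel_zero_row[OF insert.prems, of b v] insert.hyps(1) k by simp
  let ?a = "\<lambda>i v. if i < card B then (if v = b then 0 else a i v) else K v b / sqrt k"
  have g: "gram (card (insert b B)) ?a v w =
     gram (card B) (\<lambda>i v. if v = b then 0 else a i v) v w + K v b * K b w / k"
    if "v \<in> insert b B" "w \<in> insert b B" for v w
  proof -
    have "K v b / sqrt k * cnj (K w b / sqrt k) = K v b * K b w / (sqrt k * sqrt k)"
    proof -
      have "cnj (K w b) = K b w" using h[of w b] that by simp
      then show ?thesis by (simp add: complex_cnj_divide del: real_sqrt_mult_self)
    qed
    also have "\<dots> = K v b * K b w / k"
      using k(2) by (simp flip: of_real_mult)
    finally show ?thesis using insert.hyps by (simp add: gram_def)
  qed
  have "K v w = gram (card (insert b B)) ?a v w"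
    if vw: "v \<in> insert b B" "w \<in> insert b B" for v w
  proof (cases "v = b \<or> w = b")
    case True
    then have "gram (card B) (\<lambda>i v. if v = b then 0 else a i v) v w = 0"
      by (auto simp: gram_def)
    moreover have "K v b * K b w / k = K v w"
    proof (cases "k = 0")
      case z: True
      then have "K b v = 0" "K b w = 0" "K b b = 0" using row vw by auto
      moreover have "K v b = cnj (K b v)" using h[of b v] vw by simp
      ultimately show ?thesis using True by auto
    next
      case False
      then show ?thesis using True k by auto
    qed
    ultimately show ?thesis using g[OF vw] by simp
  next
    case False
    then have "v \<in> B" "w \<in> B" using vw by auto
    then have "K v w = gram (card B) a v w + K v b * K b w / k"
      using a k by (auto simp: algebra_simps)
    also have "gram (card B) a v w = gram (card B) (\<lambda>i v. if v = b then 0 else a i v) v w"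
      using False by (simp add: gram_def)
    finally show ?thesis using g[OF vw] by simp
  qed
  then show ?case by (intro exI[of _ ?a]) blast
qed simp

section \<open>The nearest point in the cone of pushed-forward Gram kernels\<close>

lemma sum_rotate:
  "(\<Sum>x\<in>A. \<Sum>y\<in>B. \<Sum>z\<in>C. h x y z) = (\<Sum>z\<in>C. \<Sum>x\<in>A. \<Sum>y\<in>B. h x y z)"
proof -
  have "(\<Sum>x\<in>A. \<Sum>y\<in>B. \<Sum>z\<in>C. h x y z) = (\<Sum>x\<in>A. \<Sum>z\<in>C. \<Sum>y\<in>B. h x y z)"
    by (rule sum.cong[OF refl], rule sum.swap)
  also have "\<dots> = (\<Sum>z\<in>C. \<Sum>x\<in>A. \<Sum>y\<in>B. h x y z)" by (rule sum.swap)
  finally show ?thesis .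
qed

text \<open>For \<open>m v w\<close> the group element $v^{-1}w$ this is the coefficient at \<open>u\<close> of
  $T(G) = \sum_{v,w} G_{vw}\, v^{-1}w$.\<close>

definition push_forward :: "'b set \<Rightarrow> ('b \<Rightarrow> 'b \<Rightarrow> 'u) \<Rightarrow> ('b \<Rightarrow> 'b \<Rightarrow> complex) \<Rightarrow> 'u \<Rightarrow> complex" where
  "push_forward B m G u = (\<Sum>v\<in>B. \<Sum>w\<in>B. if m v w = u then G v w else 0)"

lemma push_forward_cong:
  "(\<And>v w. v \<in> B \<Longrightarrow> w \<in> B \<Longrightarrow> G v w = H v w) \<Longrightarrow> push_forward B m G u = push_forward B m H u"
  unfolding push_forward_def by (auto intro!: sum.cong)

lemma push_forward_add_scaled:
  "push_forward B m (\<lambda>v w. G v w + t * H v w) u = push_forward B m G u + t * push_forward B m H u"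
  unfolding push_forward_def sum_distrib_left
  by (simp only: sum.distrib[symmetric], intro sum.cong refl) simp

text \<open>The adjoint of \<open>push_forward\<close> pulls a function \<open>l\<close> back to the kernel \<open>l (m v w)\<close>.\<close>

lemma sum_mult_push_forward:
  assumes "finite R" "\<And>v w. v \<in> B \<Longrightarrow> w \<in> B \<Longrightarrow> m v w \<in> R"
  shows "(\<Sum>u\<in>R. l u * push_forward B m G u) = (\<Sum>v\<in>B. \<Sum>w\<in>B. l (m v w) * G v w)"
proof -
  have "(\<Sum>u\<in>R. l u * push_forward B m G u)
     = (\<Sum>u\<in>R. \<Sum>v\<in>B. \<Sum>w\<in>B. if m v w = u then l u * G v w else 0)"
    unfolding push_forward_def sum_distrib_left by (intro sum.cong refl) simp
  also have "\<dots> = (\<Sum>v\<in>B. \<Sum>w\<in>B. \<Sum>u\<in>R. if m v w = u then l u * G v w else 0)"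
    by (rule sum_rotate[symmetric])
  also have "\<dots> = (\<Sum>v\<in>B. \<Sum>w\<in>B. l (m v w) * G v w)"
    using assms by (intro sum.cong refl) simp
  finally show ?thesis .
qed

lemma gram_hermitian: "gram n a w v = cnj (gram n a v w)"
  by (simp add: gram_def mult.commute)

lemma quad_form_gram:
  "quad_form B (gram n a) c = of_real (\<Sum>i<n. (cmod (\<Sum>v\<in>B. cnj (c v) * a i v))\<^sup>2)"
proof -
  have "quad_form B (gram n a) c
    = (\<Sum>v\<in>B. \<Sum>w\<in>B. \<Sum>i<n. (cnj (c v) * a i v) * cnj (cnj (c w) * a i w))"
    by (simp add: quad_form_def gram_def sum_distrib_left sum_distrib_right mult_ac)
  also have "\<dots> = (\<Sum>i<n. \<Sum>v\<in>B. \<Sum>w\<in>B. (cnj (c v) * a i v) * cnj (cnj (c w) * a i w))"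
    by (rule sum_rotate)
  also have "\<dots> = (\<Sum>i<n. (\<Sum>v\<in>B. cnj (c v) * a i v) * cnj (\<Sum>w\<in>B. cnj (c w) * a i w))"
    by (simp add: sum_product)
  also have "\<dots> = of_real (\<Sum>i<n. (cmod (\<Sum>v\<in>B. cnj (c v) * a i v))\<^sup>2)"
    by (simp only: of_real_sum complex_norm_square)
  finally show ?thesis .
qed

lemma psd_kernel_gram: "psd_kernel B (gram n a)"
proof -
  have "0 \<le> (\<Sum>i<n. (cmod (\<Sum>v\<in>B. cnj (c v) * a i v))\<^sup>2)" for c by (intro sum_nonneg) auto
  then show ?thesis
    unfolding psd_kernel_def quad_form_gram
    using gram_hermitian by (auto simp del: of_real_sum)
qed

lemma psd_kernel_add_scaled:
  assumes "psd_kernel B G" "psd_kernel B H" "0 \<le> t"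
  shows "psd_kernel B (\<lambda>v w. G v w + of_real t * H v w)"
proof -
  have "quad_form B (\<lambda>v w. G v w + of_real t * H v w) c = quad_form B G c + of_real t * quad_form B H c" for c
    unfolding quad_form_def sum_distrib_left sum.distrib[symmetric]
    by (intro sum.cong refl) (simp add: algebra_simps)
  then show ?thesis
    using assms unfolding psd_kernel_def by fastforce
qed

lemma gram_one: "gram 1 (\<lambda>_. c) v w = c v * cnj (c w)"
  by (simp add: gram_def)

lemma first_order_nonneg:
  fixes p q :: real
  assumes "\<And>t. 0 < t \<Longrightarrow> t \<le> 1 \<Longrightarrow> 0 \<le> 2 * t * p + t\<^sup>2 * q"
  shows "0 \<le> p"
proof (rule ccontr)
  assume "\<not> 0 \<le> p"
  then have p: "p < 0" by simp
  define t where "t = min 1 (- p / (\<bar>q\<bar> + 1))"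
  have t: "0 < t" "t \<le> 1" using p by (auto simp: t_def divide_neg_pos)
  have "t \<le> - p / (\<bar>q\<bar> + 1)" by (simp add: t_def)
  then have "t * (\<bar>q\<bar> + 1) \<le> - p" by (simp add: field_simps)
  moreover have "t * q \<le> t * \<bar>q\<bar>" using t by (intro mult_left_mono) auto
  ultimately have "2 * p + t * q < 0" using p t unfolding distrib_left by linarith
  then have "t * (2 * p + t * q) < 0" using t by (simp add: mult_pos_neg)
  then show False using assms[OF t] by (simp add: algebra_simps power2_eq_square)
qed

text \<open>Minimising over factors of fixed width \<open>n\<close> instead of over kernels makes positivity automatic.
  The minimum exists because a large factor has large trace, the trace is the coefficient at \<open>e\<close>,
  and so the distance to \<open>g\<close> is large outside a box; the box is compact by Tychonoff's theorem.\<close>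

lemma nearest_gram_exists:
  fixes B :: "'b set" and m :: "'b \<Rightarrow> 'b \<Rightarrow> 'u" and g :: "'u \<Rightarrow> complex" and n :: nat
  assumes fin: "finite B" "finite R" and e: "e \<in> R"
    and me: "\<And>v w. v \<in> B \<Longrightarrow> w \<in> B \<Longrightarrow> m v w = e \<longleftrightarrow> v = w"
  shows "\<exists>a. \<forall>b. (\<Sum>u\<in>R. (cmod (push_forward B m (gram n a) u - g u))\<^sup>2)
    \<le> (\<Sum>u\<in>R. (cmod (push_forward B m (gram n b) u - g u))\<^sup>2)"
proof -
  define P where "P = (\<lambda>(\<alpha> :: nat \<times> 'b \<Rightarrow> complex) u. push_forward B m (gram n (\<lambda>i v. \<alpha> (i, v))) u)"
  define F where "F \<alpha> = (\<Sum>u\<in>R. (cmod (P \<alpha> u - g u))\<^sup>2)" for \<alpha>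
  \<comment> \<open>so large that outside the box the error at \<open>e\<close> alone exceeds the error of the zero factor\<close>
  define \<rho> where "\<rho> = 1 + F (\<lambda>_. 0) + cmod (g e)"
  define box where "box = (PiE UNIV (\<lambda>_ :: nat \<times> 'b. cball (0 :: complex) \<rho>))"
  have F0: "0 \<le> F \<alpha>" for \<alpha> unfolding F_def by (intro sum_nonneg) auto
  have "compactin (product_topology (\<lambda>_. euclidean) UNIV) box"
    unfolding box_def compactin_PiE by simp
  then have "compact box" by (simp add: euclidean_product_topology)
  moreover have zero: "(\<lambda>_. 0) \<in> box" using F0[of "\<lambda>_. 0"] by (auto simp: box_def \<rho>_def)
  moreover have "continuous_on box F"
  proof -
    have "continuous_on box (\<lambda>\<alpha>. \<alpha> j)" for j :: "nat \<times> 'b"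
      by (rule continuous_on_subset[OF continuous_on_product_coordinates]) simp
    then have "continuous_on box (\<lambda>\<alpha>. if Q then gram n (\<lambda>i v. \<alpha> (i, v)) v w else 0)" for v w :: 'b and Q
      unfolding gram_def by (cases Q) (auto intro!: continuous_intros)
    then show ?thesis unfolding F_def P_def push_forward_def by (intro continuous_intros)
  qed
  ultimately obtain \<alpha> where \<alpha>: "\<alpha> \<in> box" "\<And>\<beta>. \<beta> \<in> box \<Longrightarrow> F \<alpha> \<le> F \<beta>"
    using continuous_attains_inf[of box F] by blast
  have "F \<alpha> \<le> F (\<lambda>(i, v). b i v)" for b :: "nat \<Rightarrow> 'b \<Rightarrow> complex"
  proof -
    define \<beta> where "\<beta> = (\<lambda>(i, v). if i < n \<and> v \<in> B then b i v else 0)"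
    have "P \<beta> u = P (\<lambda>(i, v). b i v) u" for u
      unfolding P_def by (intro push_forward_cong) (auto simp: gram_def \<beta>_def)
    then have eq: "F (\<lambda>(i, v). b i v) = F \<beta>" by (simp add: F_def)
    show ?thesis
    proof (cases "\<beta> \<in> box")
      case False
      then have "\<not> (\<forall>p. cmod (\<beta> p) \<le> \<rho>)" by (simp add: box_def PiE_UNIV_domain Pi_iff)
      then obtain i v where "\<rho> < cmod (\<beta> (i, v))" by (metis not_le surj_pair)
      moreover have \<rho>: "1 \<le> \<rho>" using F0[of "\<lambda>_. 0"] by (simp add: \<rho>_def)
      ultimately have iv: "i < n" "v \<in> B" "\<rho> < (cmod (b i v))\<^sup>2"
        using self_le_power[of "cmod (b i v)" 2] by (auto simp: \<beta>_def split: if_splits)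
      define tr where "tr = (\<Sum>v\<in>B. \<Sum>i<n. (cmod (b i v))\<^sup>2)"
      have "P \<beta> e = (\<Sum>v\<in>B. \<Sum>w\<in>B. if v = w then gram n b v w else 0)"
        unfolding P_def push_forward_def
        by (intro sum.cong refl) (auto simp: me gram_def \<beta>_def)
      also have "\<dots> = of_real tr"
        using fin(1) by (simp add: tr_def gram_def complex_norm_square[symmetric])
      finally have Pe: "P \<beta> e = of_real tr" .
      have "(cmod (b i v))\<^sup>2 \<le> (\<Sum>i<n. (cmod (b i v))\<^sup>2)"
        using iv by (intro member_le_sum) auto
      also have "\<dots> \<le> tr"
        unfolding tr_def using iv fin by (intro member_le_sum[of v]) (auto intro: sum_nonneg)
      finally have "1 + F (\<lambda>_. 0) \<le> tr - cmod (g e)" using iv by (simp add: \<rho>_def)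
      also have "\<dots> \<le> cmod (P \<beta> e - g e)"
        using norm_triangle_ineq2[of "P \<beta> e" "g e"] by (simp add: Pe)
      finally have 1: "1 + F (\<lambda>_. 0) \<le> cmod (P \<beta> e - g e)" .
      have "F \<alpha> \<le> F (\<lambda>_. 0)" using \<alpha> zero by blast
      also have "\<dots> \<le> cmod (P \<beta> e - g e)" using 1 by simp
      also have "\<dots> \<le> (cmod (P \<beta> e - g e))\<^sup>2"
        using 1 F0[of "\<lambda>_. 0"] by (intro self_le_power) auto
      also have "\<dots> \<le> F \<beta>"
        unfolding F_def using e fin by (intro member_le_sum) auto
      finally show ?thesis by (simp add: eq)
    qed (simp add: \<alpha> eq)
  qed
  then show ?thesis
    by (intro exI[of _ "\<lambda>i v. \<alpha> (i, v)"]) (simp add: F_def P_def)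
qed

text \<open>Here \<open>r\<close> is the difference between the nearest point and \<open>g\<close>. Moving from the Gram kernel \<open>G\<close> of
  the nearest point in the direction of a rank one kernel, or towards \<open>0\<close>, stays in the cone, since
  by \<open>psd_kernel_imp_gram\<close> the width \<open>card B\<close> suffices for every positive kernel. The derivative of
  the squared distance in these two directions is therefore nonnegative; the first gives
  positivity of the kernel obtained from \<open>r\<close>, the second the last inequality.\<close>

lemma separating_kernel:
  fixes B :: "'b set" and m :: "'b \<Rightarrow> 'b \<Rightarrow> 'u" and g :: "'u \<Rightarrow> complex"
  assumes fin: "finite B" "finite R" and e: "e \<in> R"
    and mR: "\<And>v w. v \<in> B \<Longrightarrow> w \<in> B \<Longrightarrow> m v w \<in> R"
    and me: "\<And>v w. v \<in> B \<Longrightarrow> w \<in> B \<Longrightarrow> m v w = e \<longleftrightarrow> v = w"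
  shows "\<exists>a r. (\<forall>u. r u = push_forward B m (gram (card B) a) u - g u) \<and>
    (\<forall>c. 0 \<le> Re (quad_form B (\<lambda>v w. cnj (r (m v w))) c)) \<and>
    Re (\<Sum>u\<in>R. cnj (r u) * push_forward B m (gram (card B) a) u) \<le> 0"
proof -
  define n where "n = card B"
  obtain a where a: "\<And>b. (\<Sum>u\<in>R. (cmod (push_forward B m (gram n a) u - g u))\<^sup>2)
    \<le> (\<Sum>u\<in>R. (cmod (push_forward B m (gram n b) u - g u))\<^sup>2)"
    using nearest_gram_exists[where g = g and n = n and m = m, OF fin e me] by blast
  define r where "r u = push_forward B m (gram n a) u - g u" for u
  have var: "0 \<le> Re (\<Sum>u\<in>R. cnj (r u) * push_forward B m H u)"
    if H: "\<And>t. 0 < t \<Longrightarrow> t \<le> 1 \<Longrightarrow> psd_kernel B (\<lambda>v w. gram n a v w + of_real t * H v w)" for H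
  proof (rule first_order_nonneg)
    fix t :: real assume t: "0 < t" "t \<le> 1"
    let ?h = "push_forward B m H"
    let ?G = "\<lambda>v w. gram n a v w + of_real t * H v w"
    obtain b where b: "\<forall>v\<in>B. \<forall>w\<in>B. ?G v w = gram n b v w"
      using psd_kernel_imp_gram[OF fin(1) H[OF t]] by (auto simp: n_def)
    have "(\<Sum>u\<in>R. (cmod (r u))\<^sup>2) \<le> (\<Sum>u\<in>R. (cmod (push_forward B m (gram n b) u - g u))\<^sup>2)"
      unfolding r_def by (rule a)
    also have "\<dots> = (\<Sum>u\<in>R. (cmod (push_forward B m ?G u - g u))\<^sup>2)"
      using b by (intro sum.cong refl arg_cong[where f = "\<lambda>x. (cmod (x - _))\<^sup>2"] push_forward_cong) auto
    also have "\<dots> = (\<Sum>u\<in>R. (cmod (r u))\<^sup>2 + 2 * t * Re (cnj (r u) * ?h u) + t\<^sup>2 * (cmod (?h u))\<^sup>2)"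
      unfolding push_forward_add_scaled r_def cmod_power2
      by (intro sum.cong refl) (simp add: power2_eq_square algebra_simps)
    also have "\<dots> = (\<Sum>u\<in>R. (cmod (r u))\<^sup>2) + 2 * t * Re (\<Sum>u\<in>R. cnj (r u) * ?h u)
        + t\<^sup>2 * (\<Sum>u\<in>R. (cmod (?h u))\<^sup>2)"
      by (simp only: sum.distrib sum_distrib_left Re_sum)
    finally show "0 \<le> 2 * t * Re (\<Sum>u\<in>R. cnj (r u) * ?h u) + t\<^sup>2 * (\<Sum>u\<in>R. (cmod (?h u))\<^sup>2)"
      by simp
  qed
  show ?thesis
  proof (intro exI conjI allI)
    show "r u = push_forward B m (gram (card B) a) u - g u" for u by (simp add: r_def n_def)
    fix c :: "'b \<Rightarrow> complex"
    \<comment> \<open>variation by the rank one kernel with entries $\overline{c_v} c_w$\<close>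
    have "0 \<le> Re (\<Sum>u\<in>R. cnj (r u) * push_forward B m (gram 1 (\<lambda>_ v. cnj (c v))) u)"
      by (intro var psd_kernel_add_scaled psd_kernel_gram) simp
    also have "(\<Sum>u\<in>R. cnj (r u) * push_forward B m (gram 1 (\<lambda>_ v. cnj (c v))) u)
       = quad_form B (\<lambda>v w. cnj (r (m v w))) c"
      unfolding quad_form_def
      by (subst sum_mult_push_forward[OF fin(2) mR]) (auto simp: gram_one algebra_simps simp del: One_nat_def intro!: sum.cong)
    finally show "0 \<le> Re (quad_form B (\<lambda>v w. cnj (r (m v w))) c)" .
  next
    \<comment> \<open>variation towards \<open>0\<close>; the summand \<open>0\<close> lets \<open>push_forward_add_scaled\<close> apply\<close>
    let ?H = "\<lambda>v w. 0 + of_real (- 1) * gram n a v w"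
    have "psd_kernel B (\<lambda>v w. gram n a v w + of_real t * ?H v w)" if "0 < t" "t \<le> 1" for t
    proof -
      have "psd_kernel B (\<lambda>v w. gram 0 a v w + of_real (1 - t) * gram n a v w)"
        using that by (intro psd_kernel_add_scaled psd_kernel_gram) simp
      then show ?thesis by (simp add: gram_def algebra_simps)
    qed
    from var[OF this]
    have "0 \<le> Re (\<Sum>u\<in>R. cnj (r u) * push_forward B m ?H u)" by simp
    moreover have "push_forward B m ?H u = - push_forward B m (gram n a) u" for u
      by (subst push_forward_add_scaled) (simp add: push_forward_def)
    ultimately show "Re (\<Sum>u\<in>R. cnj (r u) * push_forward B m (gram (card B) a) u) \<le> 0"
      by (simp add: sum_negf n_def)
  qed
qed

section \<open>Extending partial isometries to unitary matrices\<close>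

lemma mat_adjoint_carrier [simp]: "A \<in> carrier_mat n n \<Longrightarrow> mat_adjoint A \<in> carrier_mat n n"
  by (auto simp: mat_adjoint_def mat_of_rows_def)

lemma dim_mat_adjoint [simp]:
  "dim_row (mat_adjoint A) = dim_col A" "dim_col (mat_adjoint A) = dim_row A"
  by (simp_all add: mat_adjoint_def)

lemma mat_adjoint_index:
  "A \<in> carrier_mat n n \<Longrightarrow> i < n \<Longrightarrow> j < n \<Longrightarrow> mat_adjoint A $$ (i, j) = cnj (A $$ (j, i))"
  by (auto simp: mat_adjoint_def mat_of_rows_def)

lemma cscalar_prod_eq_sum:
  "x \<in> carrier_vec n \<Longrightarrow> y \<in> carrier_vec n \<Longrightarrow> x \<bullet>c y = (\<Sum>i<n. x $ i * cnj (y $ i))"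
  by (auto simp: scalar_prod_def lessThan_atLeast0 intro!: sum.cong)

lemma mult_mat_vec_index:
  "A \<in> carrier_mat n n \<Longrightarrow> x \<in> carrier_vec n \<Longrightarrow> i < n \<Longrightarrow> (A *\<^sub>v x) $ i = (\<Sum>j<n. A $$ (i, j) * x $ j)"
  by (auto simp: scalar_prod_def lessThan_atLeast0 intro!: sum.cong)

lemma cscalar_prod_cnj:
  fixes x y :: "complex vec"
  shows "x \<in> carrier_vec n \<Longrightarrow> y \<in> carrier_vec n \<Longrightarrow> y \<bullet>c x = cnj (x \<bullet>c y)"
  by (simp add: cscalar_prod_eq_sum mult.commute)

lemma mat_adjoint_cscalar_prod:
  fixes A :: "complex mat"
  assumes A: "A \<in> carrier_mat n n" and x: "x \<in> carrier_vec n" and y: "y \<in> carrier_vec n"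
  shows "(A *\<^sub>v x) \<bullet>c y = x \<bullet>c (mat_adjoint A *\<^sub>v y)"
proof -
  have "(A *\<^sub>v x) \<bullet>c y = (\<Sum>i<n. \<Sum>j<n. x $ j * (A $$ (i, j) * cnj (y $ i)))"
    using A x y
    by (simp add: cscalar_prod_eq_sum[of _ n] mult_mat_vec_index[of _ n] sum_distrib_left sum_distrib_right mult_ac
        del: index_mult_mat_vec)
  also have "\<dots> = (\<Sum>j<n. \<Sum>i<n. x $ j * (A $$ (i, j) * cnj (y $ i)))" by (rule sum.swap)
  also have "\<dots> = x \<bullet>c (mat_adjoint A *\<^sub>v y)"
    using A x y mult_mat_vec_carrier[OF mat_adjoint_carrier[OF A] y]
    by (simp add: cscalar_prod_eq_sum[of _ n] mult_mat_vec_index[of _ n] sum_distrib_left mat_adjoint_index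
        del: index_mult_mat_vec)
  finally show ?thesis .
qed

lemma unitary_mats_carrier: "U \<in> unitary_mats n \<Longrightarrow> U \<in> carrier_mat n n"
  by (simp add: unitary_mats_def)

lemma mat_adjoint_mult:
  "A \<in> carrier_mat n n \<Longrightarrow> B \<in> carrier_mat n n \<Longrightarrow> mat_adjoint (A * B) = mat_adjoint B * mat_adjoint A"
  for A B :: "complex mat"
proof (rule eq_matI)
  assume A: "A \<in> carrier_mat n n" and B: "B \<in> carrier_mat n n"
  fix i j assume "i < dim_row (mat_adjoint B * mat_adjoint A)" "j < dim_col (mat_adjoint B * mat_adjoint A)"
  then have ij: "i < n" "j < n"
    using mat_adjoint_carrier[OF A] mat_adjoint_carrier[OF B] by auto
  show "mat_adjoint (A * B) $$ (i, j) = (mat_adjoint B * mat_adjoint A) $$ (i, j)"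
    using A B ij mat_adjoint_carrier[OF A] mat_adjoint_carrier[OF B]
    by (simp add: mat_adjoint_index[of _ n] scalar_prod_def mult.commute)
qed auto

lemma mat_adjoint_one [simp]: "mat_adjoint (1\<^sub>m n :: complex mat) = 1\<^sub>m n"
  by (intro eq_matI) (auto simp: mat_adjoint_index[of _ n])

lemma mat_adjoint_mat_adjoint: "A \<in> carrier_mat n n \<Longrightarrow> mat_adjoint (mat_adjoint A) = A" for A :: "complex mat"
  by (intro eq_matI) (auto simp: mat_adjoint_index[of _ n])

lemma one_in_unitary_mats: "1\<^sub>m n \<in> unitary_mats n"
  by (simp add: unitary_mats_def)

lemma unitary_mats_mult:
  assumes U: "U \<in> unitary_mats n" and V: "V \<in> unitary_mats n"
  shows "U * V \<in> unitary_mats n"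
proof -
  have c: "U \<in> carrier_mat n n" "V \<in> carrier_mat n n"
    "mat_adjoint U \<in> carrier_mat n n" "mat_adjoint V \<in> carrier_mat n n"
    using U V by (auto simp: unitary_mats_def)
  have "mat_adjoint (U * V) * (U * V) = mat_adjoint V * ((mat_adjoint U * U) * V)"
    using c by (simp add: mat_adjoint_mult[OF c(1,2)] assoc_mult_mat[of _ n n _ n _ n]
        mult_carrier_mat[of _ n n _ n])
  also have "\<dots> = 1\<^sub>m n" using U V c by (simp add: unitary_mats_def)
  finally have 1: "mat_adjoint (U * V) * (U * V) = 1\<^sub>m n" .
  have "(U * V) * mat_adjoint (U * V) = U * ((V * mat_adjoint V) * mat_adjoint U)"
    using c by (simp add: mat_adjoint_mult[OF c(1,2)] assoc_mult_mat[of _ n n _ n _ n]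
        mult_carrier_mat[of _ n n _ n])
  also have "\<dots> = 1\<^sub>m n" using U V c by (simp add: unitary_mats_def)
  finally show ?thesis using 1 c by (simp add: unitary_mats_def)
qed

lemma unitary_cscalar_prod:
  assumes U: "U \<in> unitary_mats n" and x: "x \<in> carrier_vec n" and y: "y \<in> carrier_vec n"
  shows "(U *\<^sub>v x) \<bullet>c (U *\<^sub>v y) = x \<bullet>c y"
proof -
  have c: "U \<in> carrier_mat n n" using U by (simp add: unitary_mats_def)
  have "(U *\<^sub>v x) \<bullet>c (U *\<^sub>v y) = x \<bullet>c (mat_adjoint U *\<^sub>v (U *\<^sub>v y))"
    using c x y by (intro mat_adjoint_cscalar_prod) auto
  also have "mat_adjoint U *\<^sub>v (U *\<^sub>v y) = y"
    using U c y by (simp add: assoc_mult_mat_vec[of _ n n _ n, symmetric] unitary_mats_def)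
  finally show ?thesis .
qed

text \<open>The matrix $I - c\,zz^*$, a complex Householder reflection when it is unitary.\<close>

definition reflection :: "nat \<Rightarrow> complex \<Rightarrow> complex vec \<Rightarrow> complex mat" where
  "reflection n c z = mat n n (\<lambda>(i, j). (if i = j then 1 else 0) - c * z $ i * cnj (z $ j))"

lemma reflection_carrier [simp]: "reflection n c z \<in> carrier_mat n n"
  by (simp add: reflection_def)

lemma reflection_mult_vec:
  assumes z: "z \<in> carrier_vec n" and u: "u \<in> carrier_vec n"
  shows "reflection n c z *\<^sub>v u = u - (c * (u \<bullet>c z)) \<cdot>\<^sub>v z"
proof (rule eq_vecI)
  fix i assume "i < dim_vec (u - (c * (u \<bullet>c z)) \<cdot>\<^sub>v z)"
  then have i: "i < n" using z by simp
  have "(reflection n c z *\<^sub>v u) $ i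
    = (\<Sum>j<n. (if i = j then u $ j else 0) - c * z $ i * (u $ j * cnj (z $ j)))"
    using u i by (subst mult_mat_vec_index[of _ n]) (auto simp: reflection_def algebra_simps intro!: sum.cong)
  also have "\<dots> = u $ i - c * z $ i * (u \<bullet>c z)"
    using i u z by (simp add: sum_subtractf cscalar_prod_eq_sum[of _ n] sum_distrib_left)
  finally show "(reflection n c z *\<^sub>v u) $ i = (u - (c * (u \<bullet>c z)) \<cdot>\<^sub>v z) $ i"
    using i u z by (simp del: index_mult_mat_vec)
qed (use z u in \<open>simp add: reflection_def\<close>)

text \<open>Because $(zz^*)^2 = \langle z,z\rangle\, zz^*$, the product is
  $I - (c + d - cd\langle z,z\rangle)\, zz^*$.\<close>

lemma reflection_mult:
  assumes z: "z \<in> carrier_vec n" and c: "c + d = c * d * (z \<bullet>c z)"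
  shows "reflection n c z * reflection n d z = 1\<^sub>m n"
proof (rule eq_matI)
  fix i j assume "i < dim_row (1\<^sub>m n :: complex mat)" "j < dim_col (1\<^sub>m n :: complex mat)"
  then have ij: "i < n" "j < n" by auto
  have "(reflection n c z * reflection n d z) $$ (i, j) =
    (\<Sum>k<n. ((if i = k then 1 else 0) - c * z $ i * cnj (z $ k)) *
           ((if k = j then 1 else 0) - d * z $ k * cnj (z $ j)))"
    using ij by (simp add: reflection_def scalar_prod_def lessThan_atLeast0)
  also have "\<dots> = (\<Sum>k<n. (if k = i then (if i = j then 1 else 0) - d * z $ i * cnj (z $ j) else 0)
      - (if k = j then c * z $ i * cnj (z $ j) else 0)
      + c * d * z $ i * cnj (z $ j) * (z $ k * cnj (z $ k)))"
    by (intro sum.cong refl) (auto simp: algebra_simps)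
  also have "\<dots> = (if i = j then 1 else 0) - d * z $ i * cnj (z $ j) - c * z $ i * cnj (z $ j)
      + c * d * z $ i * cnj (z $ j) * (z \<bullet>c z)"
    using ij z by (simp add: sum.distrib sum_subtractf cscalar_prod_eq_sum[of _ n] sum_distrib_left)
  also have "\<dots> = (if i = j then 1 else 0) - (c + d - c * d * (z \<bullet>c z)) * (z $ i * cnj (z $ j))"
    by (simp add: algebra_simps)
  finally show "(reflection n c z * reflection n d z) $$ (i, j) = 1\<^sub>m n $$ (i, j)"
    using ij c by simp
qed (auto simp: reflection_def)

lemma mat_adjoint_reflection: "mat_adjoint (reflection n c z) = reflection n (cnj c) z"
  by (intro eq_matI) (auto simp: mat_adjoint_index[of _ n] reflection_def mult_ac)

lemma reflection_unitary:
  assumes z: "z \<in> carrier_vec n" and c: "c + cnj c = c * cnj c * (z \<bullet>c z)"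
  shows "reflection n c z \<in> unitary_mats n"
  using reflection_mult[OF z c] reflection_mult[OF z, of "cnj c" c] c
  by (simp add: unitary_mats_def mat_adjoint_reflection add.commute mult.commute)

lemma cscalar_prod_minus_left:
  "x \<in> carrier_vec n \<Longrightarrow> y \<in> carrier_vec n \<Longrightarrow> z \<in> carrier_vec n \<Longrightarrow> (x - y) \<bullet>c z = x \<bullet>c z - y \<bullet>c z"
  for x y z :: "complex vec"
  by (simp add: minus_scalar_prod_distrib[of _ n])

lemma cscalar_prod_minus_right:
  "x \<in> carrier_vec n \<Longrightarrow> y \<in> carrier_vec n \<Longrightarrow> z \<in> carrier_vec n \<Longrightarrow> x \<bullet>c (y - z) = x \<bullet>c y - x \<bullet>c z"
  for x y z :: "complex vec"
  by (simp add: cscalar_prod_eq_sum[of _ n] algebra_simps sum_subtractf)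

lemma cscalar_prod_self_eq_0: "x \<in> carrier_vec n \<Longrightarrow> x \<bullet>c x = 0 \<longleftrightarrow> x = 0\<^sub>v n" for x :: "complex vec"
  by (rule conjugate_square_eq_0_vec)

text \<open>Reflect along $z = x - y$ with $c = 1/\langle x,z\rangle$, the coefficient that sends \<open>x\<close> to
  $x - z = y$. Equality of norms gives $2\,\mathrm{Re}\,\langle x,z\rangle = \langle z,z\rangle$,
  which says both that $\langle x,z\rangle \ne 0$ and that the reflection is unitary. Vectors with
  the same inner product with \<open>x\<close> and \<open>y\<close> are orthogonal to \<open>z\<close> and stay fixed.\<close>

lemma unitary_moving_vector:
  assumes x: "x \<in> carrier_vec n" and y: "y \<in> carrier_vec n" and xy: "x \<bullet>c x = y \<bullet>c y"
  obtains W where "W \<in> unitary_mats n" "W *\<^sub>v x = y"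
    "\<And>u. u \<in> carrier_vec n \<Longrightarrow> u \<bullet>c x = u \<bullet>c y \<Longrightarrow> W *\<^sub>v u = u"
proof (cases "x = y")
  case True
  show thesis by (rule that[of "1\<^sub>m n"]) (use x True one_in_unitary_mats in auto)
next
  case False
  define z where "z = x - y"
  have z: "z \<in> carrier_vec n" using x y by (simp add: z_def)
  have "z \<noteq> 0\<^sub>v n"
  proof
    assume "z = 0\<^sub>v n"
    then have "x $ i = y $ i" if "i < n" for i
      using that x y by (auto simp: z_def vec_eq_iff)
    with False x y show False by auto
  qed
  then have zz: "z \<bullet>c z \<noteq> 0" using z by (simp add: cscalar_prod_self_eq_0)
  define p where "p = x \<bullet>c z"
  have p: "p + cnj p = z \<bullet>c z"
  proof -
    have "cnj (y \<bullet>c x) = x \<bullet>c y" "cnj (x \<bullet>c y) = y \<bullet>c x" "cnj (x \<bullet>c x) = x \<bullet>c x"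
      using x y cscalar_prod_cnj by metis+
    then show ?thesis
      using x y z xy by (simp add: p_def z_def cscalar_prod_minus_left cscalar_prod_minus_right)
  qed
  then have p0: "p \<noteq> 0" using zz by auto
  show thesis
  proof (rule that)
    have "1 / p + cnj (1 / p) = (p + cnj p) / (p * cnj p)" using p0 by (simp add: field_simps)
    then have "1 / p + cnj (1 / p) = 1 / p * cnj (1 / p) * (z \<bullet>c z)" by (simp add: p)
    then show "reflection n (1 / p) z \<in> unitary_mats n" by (rule reflection_unitary[OF z])
    have "reflection n (1 / p) z *\<^sub>v x = x - z"
      using p0 z by (simp add: reflection_mult_vec[OF z x] p_def[symmetric])
    also have "\<dots> = y" using x y by (auto simp: z_def)
    finally show "reflection n (1 / p) z *\<^sub>v x = y" .
    fix u :: "complex vec" assume u: "u \<in> carrier_vec n" "u \<bullet>c x = u \<bullet>c y"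
    then have "u \<bullet>c z = 0" using x y by (simp add: z_def cscalar_prod_minus_right)
    then show "reflection n (1 / p) z *\<^sub>v u = u"
      using u z by (auto simp: reflection_mult_vec)
  qed
qed

text \<open>Vectors are corrected one at a time: once \<open>U\<close> is right on \<open>D\<close>, equality of the Gram matrices says
  that the image of the next vector and its target have the same inner products with all targets
  from \<open>D\<close>, so a reflection repairs the new vector without disturbing the old ones.\<close>

lemma unitary_extension:
  assumes "finite D"
    and "\<And>v. v \<in> D \<Longrightarrow> x v \<in> carrier_vec n" and "\<And>v. v \<in> D \<Longrightarrow> y v \<in> carrier_vec n"
    and "\<And>v w. v \<in> D \<Longrightarrow> w \<in> D \<Longrightarrow> x v \<bullet>c x w = y v \<bullet>c y w"
  shows "\<exists>U \<in> unitary_mats n. \<forall>v\<in>D. U *\<^sub>v x v = y v"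
  using assms
proof (induction D rule: finite_induct)
  case empty
  show ?case using one_in_unitary_mats by blast
next
  case (insert b D)
  then obtain U where U: "U \<in> unitary_mats n" "\<forall>v\<in>D. U *\<^sub>v x v = y v" by auto
  have Uc: "U \<in> carrier_mat n n" using U by (simp add: unitary_mats_def)
  have xb: "x b \<in> carrier_vec n" "y b \<in> carrier_vec n" using insert.prems by auto
  have Ub: "U *\<^sub>v x b \<in> carrier_vec n" using Uc xb by simp
  have "(U *\<^sub>v x b) \<bullet>c (U *\<^sub>v x b) = y b \<bullet>c y b"
    using unitary_cscalar_prod[OF U(1) xb(1) xb(1)] insert.prems by simp
  from unitary_moving_vector[OF Ub xb(2) this] obtain W where
    W: "W \<in> unitary_mats n" "W *\<^sub>v (U *\<^sub>v x b) = y b"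
    "\<And>u. u \<in> carrier_vec n \<Longrightarrow> u \<bullet>c (U *\<^sub>v x b) = u \<bullet>c y b \<Longrightarrow> W *\<^sub>v u = u" by metis
  have Wc: "W \<in> carrier_mat n n" using W by (simp add: unitary_mats_def)
  have "(W * U) *\<^sub>v x v = y v" if "v \<in> insert b D" for v
  proof (cases "v = b")
    case True
    then show ?thesis using W(2) Wc Uc xb by (simp add: assoc_mult_mat_vec[of _ n n _ n])
  next
    case False
    then have v: "v \<in> D" using that by simp
    then have c: "x v \<in> carrier_vec n" "y v \<in> carrier_vec n" using insert.prems by auto
    have "y v \<bullet>c (U *\<^sub>v x b) = (U *\<^sub>v x v) \<bullet>c (U *\<^sub>v x b)" using U v by simp
    also have "\<dots> = y v \<bullet>c y b"
      using unitary_cscalar_prod[OF U(1) c(1) xb(1)] insert.prems(3)[of v b] v by simp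
    finally have "W *\<^sub>v y v = y v" using W(3) c by blast
    then show ?thesis using Wc Uc c U v by (simp add: assoc_mult_mat_vec[of _ n n _ n])
  qed
  then show ?case using unitary_mats_mult[OF W(1) U(1)] by blast
qed

section \<open>Unitary representations from positive definite functions\<close>

lemma letter_eval_carrier:
  "(\<And>j. U j \<in> carrier_mat n n) \<Longrightarrow> letter_eval U x \<in> carrier_mat n n"
  by (cases x) auto

lemma word_eval_carrier:
  "(\<And>j. U j \<in> carrier_mat n n) \<Longrightarrow> word_eval n U w \<in> carrier_mat n n"
  by (induction w) (auto intro!: mult_carrier_mat letter_eval_carrier)

lemma word_eval_append:
  assumes "\<And>j. U j \<in> carrier_mat n n"
  shows "word_eval n U (v @ w) = word_eval n U v * word_eval n U w"
  using word_eval_carrier[where U = U, OF assms] letter_eval_carrier[where U = U, OF assms]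
  by (induction v) (auto simp: assoc_mult_mat[of _ n n _ n _ n] left_mult_one_mat[of _ n n])

lemma letter_eval_letter_adj:
  "(\<And>j. U j \<in> carrier_mat n n) \<Longrightarrow> letter_eval U (letter_adj x) = mat_adjoint (letter_eval U x)"
  by (cases x) (auto simp: mat_adjoint_mat_adjoint[of _ n])

lemma word_eval_word_adj:
  assumes "\<And>j. U j \<in> carrier_mat n n"
  shows "word_eval n U (word_adj w) = mat_adjoint (word_eval n U w)"
  using word_eval_carrier[where U = U, OF assms] letter_eval_carrier[where U = U, OF assms]
  by (induction w)
     (auto simp: word_adj_Cons word_eval_append[OF assms] letter_eval_letter_adj[OF assms]
        mat_adjoint_mult[of _ n] right_mult_one_mat[of _ n n])

lemma nc_eval_cscalar_prod:
  assumes U: "\<And>j. U j \<in> carrier_mat n n" and x: "x \<in> carrier_vec n" and y: "y \<in> carrier_vec n"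
  shows "(nc_eval n U f *\<^sub>v x) \<bullet>c y
    = (\<Sum>w\<in>Poly_Mapping.keys f. Poly_Mapping.lookup f w * ((word_eval n U w *\<^sub>v x) \<bullet>c y))"
proof -
  have M: "nc_eval n U f \<in> carrier_mat n n" by (simp add: nc_eval_def)
  note w = word_eval_carrier[where U = U, OF U]
  have form: "(A *\<^sub>v x) \<bullet>c y = (\<Sum>i<n. \<Sum>j<n. A $$ (i, j) * (x $ j * cnj (y $ i)))"
    if "A \<in> carrier_mat n n" for A
    using that x y
    by (simp add: cscalar_prod_eq_sum[of _ n] mult_mat_vec_index[of _ n] sum_distrib_right mult.assoc
        del: index_mult_mat_vec)
  have "(nc_eval n U f *\<^sub>v x) \<bullet>c y
    = (\<Sum>i<n. \<Sum>j<n. \<Sum>w\<in>Poly_Mapping.keys f.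
         Poly_Mapping.lookup f w * (word_eval n U w $$ (i, j) * (x $ j * cnj (y $ i))))"
    unfolding form[OF M] by (simp add: nc_eval_def sum_distrib_right mult.assoc)
  also have "\<dots> = (\<Sum>w\<in>Poly_Mapping.keys f. \<Sum>i<n. \<Sum>j<n.
         Poly_Mapping.lookup f w * (word_eval n U w $$ (i, j) * (x $ j * cnj (y $ i))))"
    by (rule sum_rotate)
  finally show ?thesis
    by (simp add: form[OF w] sum_distrib_left)
qed

text \<open>Truncated GNS construction. A factorisation of the kernel gives vectors $x_v$ with
  $\langle x_w, x_v\rangle = k(v^{-1}w)$ for \<open>v\<close>, \<open>w\<close> in the ball. The partial map
  $x_v \mapsto x_{X_j v}$, defined where $X_j v$ is still in the ball, preserves inner products
  and extends to a unitary. Letter by letter, from right to left, a word of length at most \<open>d\<close> then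
  carries $x_1$ to the vector of its reduction without ever leaving the ball.\<close>

lemma gns_unitaries:
  fixes k :: "'g::finite letter list \<Rightarrow> complex"
  assumes psd: "psd_kernel (word_ball d) (\<lambda>v w. k (quot v w))"
    and N: "card (word_ball d :: 'g letter list set) \<le> N"
  shows "\<exists>(U :: 'g \<Rightarrow> complex mat) \<xi>. (\<forall>j. U j \<in> unitary_mats N) \<and> \<xi> \<in> carrier_vec N \<and>
    (\<forall>v w. length v \<le> d \<longrightarrow> length w \<le> d \<longrightarrow>
       (word_eval N U w *\<^sub>v \<xi>) \<bullet>c (word_eval N U v *\<^sub>v \<xi>) = k (quot v w))"
proof -
  let ?B = "word_ball d :: 'g letter list set"
  obtain a where a: "\<And>v w. v \<in> ?B \<Longrightarrow> w \<in> ?B \<Longrightarrow> k (quot v w) = gram (card ?B) a v w"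
    using psd_kernel_imp_gram[OF finite_word_ball psd] by blast
  \<comment> \<open>conjugated because the kernel at \<open>v\<close>, \<open>w\<close> has to become \<open>x w \<bullet>c x v\<close>; padded
    with zeros up to dimension \<open>N\<close>\<close>
  define x where "x v = Matrix.vec N (\<lambda>i. if i < card ?B then cnj (a i v) else 0)" for v
  have x: "x v \<in> carrier_vec N" for v by (simp add: x_def)
  have inner: "x w \<bullet>c x v = k (quot v w)" if "v \<in> ?B" "w \<in> ?B" for v w
  proof -
    have "x w \<bullet>c x v = (\<Sum>i<N. if i < card ?B then cnj (a i w) * a i v else 0)"
      unfolding cscalar_prod_eq_sum[OF x x] by (intro sum.cong) (auto simp: x_def)
    also have "\<dots> = gram (card ?B) a v w"
      unfolding gram_def using N
      by (intro sum.mono_neutral_cong_right) (auto simp: mult.commute)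
    finally show ?thesis using a that by simp
  qed
  have "\<exists>U\<in>unitary_mats N. \<forall>v\<in>{v \<in> ?B. push (Var j) v \<in> ?B}. U *\<^sub>v x v = x (push (Var j) v)" for j
    by (rule unitary_extension)
       (auto simp: x inner quot_push word_ball_reduced intro: finite_subset[OF _ finite_word_ball])
  then obtain U where U: "\<And>j. U j \<in> unitary_mats N"
    "\<And>j v. v \<in> ?B \<Longrightarrow> push (Var j) v \<in> ?B \<Longrightarrow> U j *\<^sub>v x v = x (push (Var j) v)"
    by (metis (mono_tags, lifting) mem_Collect_eq)
  have Uc: "U j \<in> carrier_mat N N" for j using U(1) by (rule unitary_mats_carrier)
  have letter: "letter_eval U l *\<^sub>v x v = x (push l v)" if "v \<in> ?B" "push l v \<in> ?B" for l v
  proof (cases l)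
    case (Var j)
    then show ?thesis using U(2) that by simp
  next
    case (VarT j)
    let ?v = "push (VarT j) v"
    \<comment> \<open>the adjoint of \<open>U j\<close> undoes the shift by \<open>Var j\<close>, which maps \<open>?v\<close> to \<open>v\<close>\<close>
    have "push (Var j) ?v = v"
      using push_push_letter_adj[of v "Var j"] word_ball_reduced[OF that(1)] by simp
    then have "U j *\<^sub>v x ?v = x v" using U(2)[of ?v j] that VarT by simp
    then have "mat_adjoint (U j) *\<^sub>v x v = (mat_adjoint (U j) * U j) *\<^sub>v x ?v"
      using Uc x by (metis assoc_mult_mat_vec mat_adjoint_carrier)
    also have "\<dots> = x ?v" using U(1)[of j] x by (simp add: unitary_mats_def)
    finally show ?thesis by (simp add: VarT)
  qed
  have word: "word_eval N U w *\<^sub>v x [] = x (red w)" if "length w \<le> d" for w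
    using that
  proof (induction w)
    case Nil
    then show ?case using x by simp
  next
    case (Cons l w)
    have "word_eval N U (l # w) *\<^sub>v x [] = letter_eval U l *\<^sub>v (word_eval N U w *\<^sub>v x [])"
      using word_eval_carrier[where U = U, OF Uc] letter_eval_carrier[where U = U, OF Uc] x
      by (simp add: assoc_mult_mat_vec[of _ N N _ N])
    also have "\<dots> = letter_eval U l *\<^sub>v x (red w)" using Cons by simp
    also have "\<dots> = x (push l (red w))"
      using red_in_word_ball[of w d] red_in_word_ball[of "l # w" d] Cons.prems
      by (intro letter) (auto simp: red_Cons)
    finally show ?case by (simp add: red_Cons)
  qed
  show ?thesis
    by (intro exI[of _ U] exI[of _ "x []"]) (auto simp: U(1) x word inner red_in_word_ball quot_red)
qed


section \<open>Coefficients in the group algebra\<close>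

text \<open>The coefficient at the group element \<open>u\<close> of the image of \<open>f\<close> in the group algebra.\<close>

definition group_coeff :: "'g ncpoly \<Rightarrow> 'g letter list \<Rightarrow> complex" where
  "group_coeff f u = (\<Sum>w\<in>Poly_Mapping.keys f. if red w = u then Poly_Mapping.lookup f w else 0)"

lemma sum_mult_group_coeff:
  assumes "finite R" "\<And>w. w \<in> Poly_Mapping.keys f \<Longrightarrow> red w \<in> R"
  shows "(\<Sum>u\<in>R. l u * group_coeff f u) = (\<Sum>w\<in>Poly_Mapping.keys f. Poly_Mapping.lookup f w * l (red w))"
proof -
  have "(\<Sum>u\<in>R. l u * group_coeff f u)
    = (\<Sum>w\<in>Poly_Mapping.keys f. \<Sum>u\<in>R. if red w = u then Poly_Mapping.lookup f w * l u else 0)"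
    unfolding group_coeff_def sum_distrib_left
    by (subst sum.swap) (auto intro!: sum.cong)
  then show ?thesis using assms by (simp cong: sum.cong)
qed

text \<open>A positive definite function on the ball is a vector state of a unitary tuple of size \<open>N\<close>; the
  sum is $\langle f(U)\xi,\xi\rangle$.\<close>

lemma positive_on_unitaries_imp_nonneg:
  fixes f :: "'g::finite ncpoly"
  assumes psd: "psd_kernel (word_ball d) (\<lambda>v w. k (quot v w))"
    and N: "card (word_ball d :: 'g letter list set) \<le> N"
    and deg: "\<And>w. w \<in> Poly_Mapping.keys f \<Longrightarrow> length w \<le> d"
    and pos: "positive_on N {U. \<forall>j. U j \<in> unitary_mats N} f"
  shows "0 \<le> Re (\<Sum>w\<in>Poly_Mapping.keys f. Poly_Mapping.lookup f w * k (red w))"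
proof -
  from gns_unitaries[OF psd N] obtain U \<xi> where U: "\<And>j. U j \<in> unitary_mats N"
    and \<xi>: "\<xi> \<in> carrier_vec N"
    and ip: "\<And>v w. length v \<le> d \<Longrightarrow> length w \<le> d \<Longrightarrow>
       (word_eval N U w *\<^sub>v \<xi>) \<bullet>c (word_eval N U v *\<^sub>v \<xi>) = k (quot v w)" by blast
  have Uc: "U j \<in> carrier_mat N N" for j using U by (rule unitary_mats_carrier)
  have "0 \<le> (nc_eval N U f *\<^sub>v \<xi>) \<bullet>c \<xi>"
    using pos U \<xi> by (auto simp: positive_on_def psd_mat_def)
  also have "\<dots> = (\<Sum>w\<in>Poly_Mapping.keys f. Poly_Mapping.lookup f w * k (red w))"
    unfolding nc_eval_cscalar_prod[OF Uc \<xi> \<xi>]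
    using ip[of "[]"] deg \<xi> by (intro sum.cong) (auto simp: quot_def)
  finally show ?thesis by (simp add: less_eq_complex_def)
qed

text \<open>The function \<open>\<lambda>u. of_bool (u = [])\<close> is positive definite, since its kernel on the ball is the
  identity. In the associated representation the vectors $u(U)\xi$ are orthonormal, so that
  $\langle f(U)\xi, u(U)\xi\rangle$ is the coefficient of \<open>f\<close> at \<open>u\<close>, while
  $\langle f(U)u(U)\xi, \xi\rangle$ is the one at $u^{-1}$. As \<open>f(U)\<close> is Hermitian, the two are
  conjugate. Outside the ball of radius \<open>d\<close> both coefficients vanish.\<close>

lemma group_coeff_hermitian:
  fixes f :: "'g::finite ncpoly"
  assumes N: "card (word_ball d :: 'g letter list set) \<le> N"
    and deg: "\<And>w. w \<in> Poly_Mapping.keys f \<Longrightarrow> length w \<le> d"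
    and pos: "positive_on N {U. \<forall>j. U j \<in> unitary_mats N} f"
    and u: "reduced u"
  shows "group_coeff f (red (word_adj u)) = cnj (group_coeff f u)"
proof (cases "length u \<le> d")
  case True
  let ?k = "\<lambda>u. of_bool (u = []) :: complex"
  have "quad_form (word_ball d :: 'g letter list set) (\<lambda>v w. ?k (quot v w)) c
    = of_real (\<Sum>v\<in>word_ball d. (cmod (c v))\<^sup>2)" for c
  proof -
    have "quad_form (word_ball d) (\<lambda>v w. ?k (quot v w)) c
      = (\<Sum>v\<in>word_ball d. \<Sum>w\<in>word_ball d. if v = w then cnj (c v) * c w else 0)"
      unfolding quad_form_def
      by (intro sum.cong refl) (simp add: quot_eq_Nil_iff word_ball_reduced)
    also have "\<dots> = of_real (\<Sum>v\<in>word_ball d. (cmod (c v))\<^sup>2)"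
      by (simp add: finite_word_ball complex_norm_square mult.commute del: of_real_power)
    finally show ?thesis .
  qed
  then have "psd_kernel (word_ball d :: 'g letter list set) (\<lambda>v w. ?k (quot v w))"
    by (auto simp: psd_kernel_def quot_eq_Nil_iff word_ball_reduced sum_nonneg simp del: of_real_sum)
  from gns_unitaries[where k = ?k, OF this N] obtain U :: "'g \<Rightarrow> complex mat" and \<xi> where U: "\<And>j. U j \<in> unitary_mats N"
    and \<xi>: "\<xi> \<in> carrier_vec N"
    and ip: "\<And>v w. length v \<le> d \<Longrightarrow> length w \<le> d \<Longrightarrow>
       (word_eval N U w *\<^sub>v \<xi>) \<bullet>c (word_eval N U v *\<^sub>v \<xi>) = ?k (quot v w)" by blast
  have Uc: "U j \<in> carrier_mat N N" for j using U by (rule unitary_mats_carrier)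
  note wc = word_eval_carrier[where U = U, OF Uc]
  let ?M = "nc_eval N U f" and ?y = "word_eval N U u *\<^sub>v \<xi>"
  have y: "?y \<in> carrier_vec N" by (rule mult_mat_vec_carrier[OF wc \<xi>])
  have M: "?M \<in> carrier_mat N N" "mat_adjoint ?M = ?M"
    using pos U by (auto simp: positive_on_def psd_mat_def)
  have 1: "(?M *\<^sub>v \<xi>) \<bullet>c ?y = group_coeff f u"
    unfolding nc_eval_cscalar_prod[OF Uc \<xi> y] group_coeff_def
    using ip deg True u by (intro sum.cong) (auto simp: quot_eq_Nil_iff_red red_reduced)
  have 2: "(?M *\<^sub>v ?y) \<bullet>c \<xi> = group_coeff f (red (word_adj u))"
    unfolding nc_eval_cscalar_prod[OF Uc y \<xi>] group_coeff_def
  proof (intro sum.cong refl)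
    fix w assume w: "w \<in> Poly_Mapping.keys f"
    have "(word_eval N U w *\<^sub>v ?y) \<bullet>c \<xi> = ?y \<bullet>c (word_eval N U (word_adj w) *\<^sub>v \<xi>)"
      using mat_adjoint_cscalar_prod[OF wc y \<xi>] by (simp add: word_eval_word_adj[OF Uc])
    also have "\<dots> = ?k (quot (word_adj w) u)" using ip deg[OF w] True by simp
    also have "\<dots> = of_bool (red w = red (word_adj u))"
      by (simp add: quot_eq_Nil_iff_red red_word_adj_eq_iff)
    finally show "Poly_Mapping.lookup f w * ((word_eval N U w *\<^sub>v ?y) \<bullet>c \<xi>)
      = (if red w = red (word_adj u) then Poly_Mapping.lookup f w else 0)" by simp
  qed
  have "(?M *\<^sub>v \<xi>) \<bullet>c ?y = \<xi> \<bullet>c (?M *\<^sub>v ?y)"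
    using mat_adjoint_cscalar_prod[OF M(1) \<xi> y] M(2) by simp
  also have "\<dots> = cnj ((?M *\<^sub>v ?y) \<bullet>c \<xi>)"
    using M(1) y \<xi> by (intro cscalar_prod_cnj[of _ N]) auto
  finally show ?thesis by (simp add: 1 2)
next
  case False
  have "red w \<noteq> u" "red w \<noteq> red (word_adj u)" if "w \<in> Poly_Mapping.keys f" for w
  proof -
    show "red w \<noteq> u" using False deg[OF that] length_red[of w] by auto
    show "red w \<noteq> red (word_adj u)"
    proof
      assume "red w = red (word_adj u)"
      then have "red (word_adj w) = u" using u by (simp add: red_word_adj_eq_iff[symmetric] red_reduced)
      then show False using False deg[OF that] length_red[of "word_adj w"] by auto
    qed
  qed
  then show ?thesis by (simp add: group_coeff_def)
qed

section \<open>Sums of squares modulo the unitarity relations\<close>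

lemma lookup_scaleR: "Poly_Mapping.lookup (r *\<^sub>R x) k = r *\<^sub>R Poly_Mapping.lookup x k"
proof -
  have "finite {i. r *\<^sub>R Poly_Mapping.lookup x i \<noteq> 0}"
    by (rule finite_subset[OF _ finite_lookup[of x]]) auto
  then show ?thesis by (simp add: scaleR_poly_mapping_def Abs_poly_mapping_inverse)
qed

lemma scaleR_single: "r *\<^sub>R Poly_Mapping.single w c = Poly_Mapping.single w (r *\<^sub>R c)"
  by (rule poly_mapping_eqI) (simp add: lookup_scaleR lookup_single when_def)

lemma single_sum: "Poly_Mapping.single w (sum c A) = (\<Sum>i\<in>A. Poly_Mapping.single w (c i))"
  by (induction A rule: infinite_finite_induct) (auto simp: single_add)

definition lin_comb :: "'g letter list set \<Rightarrow> ('g letter list \<Rightarrow> complex) \<Rightarrow> 'g ncpoly" where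
  "lin_comb B c = (\<Sum>v\<in>B. Poly_Mapping.single v (c v))"

lemma lookup_lin_comb: "finite B \<Longrightarrow> Poly_Mapping.lookup (lin_comb B c) w = (if w \<in> B then c w else 0)"
  by (simp add: lin_comb_def lookup_sum lookup_single when_def)

lemma lin_comb_keys: "f = lin_comb (Poly_Mapping.keys f) (Poly_Mapping.lookup f)"
  by (rule poly_mapping_eqI) (simp add: lookup_lin_comb in_keys_iff)

lemma keys_lin_comb: "finite B \<Longrightarrow> Poly_Mapping.keys (lin_comb B c) \<subseteq> B"
  by (auto simp: in_keys_iff lookup_lin_comb split: if_splits)

lemma nc_adj_lin_comb:
  assumes "finite B"
  shows "nc_adj (lin_comb B c) = (\<Sum>v\<in>B. Poly_Mapping.single (word_adj v) (cnj (c v)))"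
  unfolding nc_adj_def using assms keys_lin_comb[OF assms, of c]
  by (intro sum.mono_neutral_cong_left) (auto simp: in_keys_iff lookup_lin_comb)

lemma hermitian_square_lin_comb:
  assumes "finite B"
  shows "nc_adj (lin_comb B c) * lin_comb B c
    = (\<Sum>v\<in>B. \<Sum>w\<in>B. Poly_Mapping.single (word_adj v @ w) (cnj (c v) * c w))"
  unfolding nc_adj_lin_comb[OF assms] unfolding lin_comb_def
  by (simp add: sum_product mult_single plus_list_def)

text \<open>Column \<open>i\<close> of the factor is, up to conjugation, the coefficient vector of a polynomial $p_i$, and
  the sum is $\sum_i p_i^\intercal p_i$.\<close>

lemma sum_gram_in_sos_cone:
  fixes B :: "'g letter list set"
  assumes B: "finite B" "\<And>w. w \<in> B \<Longrightarrow> length w \<le> d" and n: "0 < n"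
  shows "(\<Sum>v\<in>B. \<Sum>w\<in>B. Poly_Mapping.single (word_adj v @ w) (gram n a v w)) \<in> sos_cone d"
proof -
  \<comment> \<open>the scaling turns the sum of \<open>n\<close> squares into an average, which lies in the convex hull\<close>
  define c where "c i v = of_real (sqrt n) * cnj (a i v)" for i v
  let ?p = "\<lambda>i. lin_comb B (c i)"
  have "?p i \<in> polys_upto d" for i
    using keys_lin_comb[OF B(1), of "c i"] B by (auto simp: polys_upto_def nc_degree_def)
  then have "nc_adj (?p i) * ?p i \<in> sos_cone d" for i
    unfolding sos_cone_def by (intro hull_inc) blast
  moreover have "convex (sos_cone d :: 'g ncpoly set)" by (simp add: sos_cone_def)
  ultimately have "(\<Sum>i<n. (1 / n) *\<^sub>R (nc_adj (?p i) * ?p i)) \<in> sos_cone d"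
    using n by (intro convex_sum) auto
  also have "(\<Sum>i<n. (1 / n) *\<^sub>R (nc_adj (?p i) * ?p i))
    = (\<Sum>i<n. \<Sum>v\<in>B. \<Sum>w\<in>B. Poly_Mapping.single (word_adj v @ w) (a i v * cnj (a i w)))"
  proof -
    have "(1 / real n) *\<^sub>R (cnj (c i v) * c i w) = a i v * cnj (a i w)" for i v w
    proof -
      have "cnj (c i v) * c i w = of_real (sqrt n * sqrt n) * (a i v * cnj (a i w))"
        unfolding c_def of_real_mult by (simp add: mult_ac)
      then show ?thesis using n by (simp add: scaleR_conv_of_real)
    qed
    then show ?thesis
      by (simp only: hermitian_square_lin_comb[OF B(1)] scaleR_sum_right scaleR_single)
  qed
  also have "\<dots> = (\<Sum>v\<in>B. \<Sum>w\<in>B. Poly_Mapping.single (word_adj v @ w) (gram n a v w))"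
    unfolding gram_def single_sum
    by (rule sum_rotate[symmetric])
  finally show ?thesis .
qed

lemma ideal_unitary_ideal: "ideal (unitary_ideal :: 'g ncpoly set) class_ring"
  unfolding unitary_ideal_def by (rule ring.genideal_ideal[OF class_ring.ring_axioms]) simp

lemma
  fixes p q :: "'g ncpoly"
  shows unitary_ideal_zero: "(0 :: 'g ncpoly) \<in> unitary_ideal"
  and unitary_ideal_add: "p \<in> unitary_ideal \<Longrightarrow> q \<in> unitary_ideal \<Longrightarrow> p + q \<in> unitary_ideal"
  and unitary_ideal_mult_left: "p \<in> unitary_ideal \<Longrightarrow> q * p \<in> unitary_ideal"
  and unitary_ideal_mult_right: "p \<in> unitary_ideal \<Longrightarrow> p * q \<in> unitary_ideal"
proof -
  interpret I: ideal unitary_ideal "class_ring :: 'g ncpoly ring" by (rule ideal_unitary_ideal)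
  show "(0 :: 'g ncpoly) \<in> unitary_ideal" using I.zero_closed by simp
  show "p \<in> unitary_ideal \<Longrightarrow> q \<in> unitary_ideal \<Longrightarrow> p + q \<in> unitary_ideal"
    using I.a_closed by simp
  show "p \<in> unitary_ideal \<Longrightarrow> q * p \<in> unitary_ideal" using I.I_l_closed by simp
  show "p \<in> unitary_ideal \<Longrightarrow> p * q \<in> unitary_ideal" using I.I_r_closed by simp
qed

lemma unitary_ideal_uminus: "p \<in> unitary_ideal \<Longrightarrow> - p \<in> unitary_ideal"
  using unitary_ideal_mult_left[of p "- 1"] by simp

lemma unitary_ideal_diff: "p \<in> unitary_ideal \<Longrightarrow> q \<in> unitary_ideal \<Longrightarrow> p - q \<in> unitary_ideal"
  using unitary_ideal_add[of p "- q"] unitary_ideal_uminus[of q] by simp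

lemma unitary_ideal_sum:
  "(\<And>i. i \<in> A \<Longrightarrow> p i \<in> unitary_ideal) \<Longrightarrow> sum p A \<in> unitary_ideal"
  by (induction A rule: infinite_finite_induct) (auto intro: unitary_ideal_zero unitary_ideal_add)

lemma letter_relation:
  "Poly_Mapping.single [] 1 - Poly_Mapping.single [x, letter_adj x] 1 \<in> unitary_ideal"
proof -
  have "Poly_Mapping.single [] 1 - Poly_Mapping.single [x, letter_adj x] 1 \<in> unitary_relations"
    by (cases x)
       (auto simp: unitary_relations_def nc_var_def nc_varT_def mult_single plus_list_def
          single_one[symmetric] zero_list_def)
  then show ?thesis
    unfolding unitary_ideal_def using ring.genideal_self[OF class_ring.ring_axioms, of unitary_relations] by auto
qed

text \<open>The residue class of a monomial, here taken as the set of all \<open>h\<close> congruent to it, is invariant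
  under cancellation: deleting $x x^\intercal$ inside a word changes the monomial by a multiple of
  $1 - x x^\intercal$.\<close>

lemma single_red_cong:
  "Poly_Mapping.single w c - Poly_Mapping.single (red w) c \<in> unitary_ideal"
proof -
  let ?F = "\<lambda>w. {h. h - Poly_Mapping.single w c \<in> unitary_ideal}"
  have "?F (a @ x # letter_adj x # b) = ?F (a @ b)" for a x b
  proof -
    let ?p = "Poly_Mapping.single (a @ x # letter_adj x # b) c" and ?q = "Poly_Mapping.single (a @ b) c"
    have "?q - ?p = Poly_Mapping.single a c *
        (Poly_Mapping.single [] 1 - Poly_Mapping.single [x, letter_adj x] 1) * Poly_Mapping.single b 1"
      by (simp add: algebra_simps mult_single plus_list_def)
    then have qp: "?q - ?p \<in> unitary_ideal"
      by (simp only: unitary_ideal_mult_left unitary_ideal_mult_right letter_relation)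
    have "h - ?p = (h - ?q) + (?q - ?p)" "h - ?q = (h - ?p) - (?q - ?p)" for h
      by simp_all
    then show ?thesis using qp unitary_ideal_add unitary_ideal_diff by (metis (no_types, lifting))
  qed
  from cancellation_invariant_red[of ?F, OF this] have "?F (red w) = ?F w" .
  moreover have "Poly_Mapping.single w c \<in> ?F w" by (simp add: unitary_ideal_zero)
  ultimately show ?thesis by blast
qed


section \<open>Positivity on unitaries\<close>

theorem corollary4p13:
  fixes f :: "'g::finite ncpoly" and d :: nat
  assumes "d \<ge> 1"
    and "nc_degree f = d - 1"
    and "positive_on ((2 * CARD('g) + 1) ^ d)
           {U. \<forall>j. U j \<in> unitary_mats ((2 * CARD('g) + 1) ^ d)} f"
  shows "f \<in> sos_cone d + unitary_ideal"
proof -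
  define B :: "'g letter list set" where "B = word_ball d"
  define R :: "'g letter list set" where "R = word_ball (2 * d)"
  define N where "N = (2 * CARD('g) + 1) ^ d"
  define g where "g = group_coeff f"
  define n where "n = card B"
  have fin: "finite B" "finite R" by (simp_all add: B_def R_def finite_word_ball)
  have "[] \<in> B" by (simp add: B_def word_ball_def)
  then have n0: "0 < n" using fin(1) by (auto simp: n_def card_gt_0_iff)
  have N: "card (word_ball d :: 'g letter list set) \<le> N" unfolding N_def by (rule card_word_ball)
  have pos: "positive_on N {U. \<forall>j. U j \<in> unitary_mats N} f" using assms by (simp add: N_def)
  have deg: "length w \<le> d" if "w \<in> Poly_Mapping.keys f" for w
  proof -
    have "length w \<le> nc_degree f" unfolding nc_degree_def using that by (intro Max_ge) auto
    then show ?thesis using assms(2) by simp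
  qed
  have quotR: "quot v w \<in> R" if "v \<in> B" "w \<in> B" for v w
    using that quot_in_word_ball by (simp add: B_def R_def)
  have redR: "red w \<in> R" if "w \<in> Poly_Mapping.keys f" for w
    unfolding R_def using deg[OF that] by (intro red_in_word_ball) simp
  have quotNil: "quot v w = [] \<longleftrightarrow> v = w" if "v \<in> B" "w \<in> B" for v w
    using that by (simp add: B_def quot_eq_Nil_iff word_ball_reduced)
  have NilR: "[] \<in> R" by (simp add: R_def word_ball_def)
  obtain a r where r: "\<And>u. r u = push_forward B quot (gram n a) u - g u"
    and psd: "\<And>c. 0 \<le> Re (quad_form B (\<lambda>v w. cnj (r (quot v w))) c)"
    and le: "Re (\<Sum>u\<in>R. cnj (r u) * push_forward B quot (gram n a) u) \<le> 0"
    using separating_kernel[where g = g and m = quot, OF fin NilR quotR quotNil, folded n_def]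
    by blast
  \<comment> \<open>positivity is known; Hermitian symmetry of \<open>r\<close> comes from that of \<open>gram n a\<close> and of \<open>g\<close>\<close>
  have "psd_kernel B (\<lambda>v w. cnj (r (quot v w)))"
    unfolding psd_kernel_def
  proof (intro conjI ballI allI psd)
    fix v w assume vw: "v \<in> B" "w \<in> B"
    let ?u = "quot v w"
    have u: "reduced ?u" by (simp add: quot_def reduced_red)
    have "push_forward B quot (gram n a) (red (word_adj ?u)) = cnj (push_forward B quot (gram n a) ?u)"
    proof -
      have "push_forward B quot (gram n a) (red (word_adj ?u))
        = (\<Sum>v'\<in>B. \<Sum>w'\<in>B. if quot w' v' = ?u then cnj (gram n a w' v') else 0)"
        unfolding push_forward_def quot_eq_red_word_adj_iff[OF u] gram_hermitian[symmetric] ..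
      also have "\<dots> = cnj (push_forward B quot (gram n a) ?u)"
        unfolding push_forward_def cnj_sum by (subst sum.swap) (auto intro!: sum.cong)
      finally show ?thesis .
    qed
    moreover have "g (red (word_adj ?u)) = cnj (g ?u)"
      unfolding g_def by (rule group_coeff_hermitian[OF N deg pos u])
    ultimately have "r (quot w v) = cnj (r ?u)" by (simp add: r red_word_adj_quot)
    then show "cnj (r (quot w v)) = cnj (cnj (r (quot v w)))" by simp
  qed
  then have "0 \<le> Re (\<Sum>w\<in>Poly_Mapping.keys f. Poly_Mapping.lookup f w * cnj (r (red w)))"
    unfolding B_def by (rule positive_on_unitaries_imp_nonneg[OF _ N deg pos])
  also have "(\<Sum>w\<in>Poly_Mapping.keys f. Poly_Mapping.lookup f w * cnj (r (red w)))
    = (\<Sum>u\<in>R. cnj (r u) * g u)"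
    unfolding g_def by (rule sum_mult_group_coeff[OF fin(2) redR, symmetric])
  \<comment> \<open>the pairing with \<open>r\<close> has real part at most \<open>0\<close> on the nearest point and at least \<open>0\<close> on \<open>g\<close>\<close>
  finally have "Re (\<Sum>u\<in>R. cnj (r u) * r u) \<le> 0"
    using le by (simp add: r algebra_simps sum_subtractf)
  then have "(\<Sum>u\<in>R. (cmod (r u))\<^sup>2) \<le> 0"
    unfolding cmod_power2 by (simp add: power2_eq_square)
  moreover have "0 \<le> (\<Sum>u\<in>R. (cmod (r u))\<^sup>2)" by (intro sum_nonneg) simp
  ultimately have "(\<Sum>u\<in>R. (cmod (r u))\<^sup>2) = 0" by simp
  then have eq: "push_forward B quot (gram n a) u = g u" if "u \<in> R" for u
    using that fin(2) r[of u] by (simp add: sum_nonneg_eq_0_iff)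
  define s where "s = (\<Sum>v\<in>B. \<Sum>w\<in>B. Poly_Mapping.single (word_adj v @ w) (gram n a v w))"
  have s: "s \<in> sos_cone d"
    unfolding s_def by (rule sum_gram_in_sos_cone[OF fin(1) _ n0]) (simp add: B_def word_ball_def)
  \<comment> \<open>both \<open>s\<close> and \<open>f\<close> are congruent to combinations of reduced words, which agree by \<open>eq\<close>\<close>
  have "s - (\<Sum>v\<in>B. \<Sum>w\<in>B. Poly_Mapping.single (quot v w) (gram n a v w)) \<in> unitary_ideal"
    unfolding s_def sum_subtractf[symmetric] quot_def
    by (intro unitary_ideal_sum single_red_cong)
  moreover have "f - (\<Sum>w\<in>Poly_Mapping.keys f. Poly_Mapping.single (red w) (Poly_Mapping.lookup f w)) \<in> unitary_ideal"
    by (subst (1) lin_comb_keys, unfold lin_comb_def sum_subtractf[symmetric])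
       (intro unitary_ideal_sum single_red_cong)
  moreover have "(\<Sum>v\<in>B. \<Sum>w\<in>B. Poly_Mapping.single (quot v w) (gram n a v w))
    = (\<Sum>w\<in>Poly_Mapping.keys f. Poly_Mapping.single (red w) (Poly_Mapping.lookup f w))"
  proof (rule poly_mapping_eqI)
    fix u
    have 1: "Poly_Mapping.lookup (\<Sum>v\<in>B. \<Sum>w\<in>B. Poly_Mapping.single (quot v w) (gram n a v w)) u
      = push_forward B quot (gram n a) u"
      by (simp add: push_forward_def lookup_sum lookup_single when_def)
    have 2: "Poly_Mapping.lookup (\<Sum>w\<in>Poly_Mapping.keys f. Poly_Mapping.single (red w) (Poly_Mapping.lookup f w)) u
      = g u"
      by (simp add: g_def group_coeff_def lookup_sum lookup_single when_def)
    show "Poly_Mapping.lookup (\<Sum>v\<in>B. \<Sum>w\<in>B. Poly_Mapping.single (quot v w) (gram n a v w)) u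
      = Poly_Mapping.lookup (\<Sum>w\<in>Poly_Mapping.keys f. Poly_Mapping.single (red w) (Poly_Mapping.lookup f w)) u"
    proof (cases "u \<in> R")
      case True
      then show ?thesis by (simp only: 1 2 eq)
    next
      case False
      then have "push_forward B quot (gram n a) u = 0"
        unfolding push_forward_def using quotR by (intro sum.neutral ballI) auto
      moreover have "g u = 0"
        unfolding g_def group_coeff_def using redR False by (intro sum.neutral) auto
      ultimately show ?thesis by (simp only: 1 2)
    qed
  qed
  ultimately have "f - s \<in> unitary_ideal"
    using unitary_ideal_diff by fastforce
  then have "s + (f - s) \<in> sos_cone d + unitary_ideal" by (intro set_plus_intro s)
  then show ?thesis by simp
qed

end
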